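(* Let $N=(D=(V\cup \{s\},A),\tau)$ be a consistent pre-flow temporal network. Then there exist $d^+_D(s)$ pairwise arc-disjoint $\tau$-respecting $s$-arborescences in $D$ such that each vertex $v\in V$ belongs to exactly $\lambda_N(s,v)$ of them.
   Context: A temporal network is a pair $N=(D,\tau)$ where $D=(V\cup\{s\},A)$ is a directed graph (parallel arcs allowed) with a root $s$ that no arc enters, and $\tau:A\to\mathbb{N}$. $d^+_D(s)$ is the number of arcs leaving $s$. For $i\in\mathbb{N}$, $\rho_N^i(v)=\{a \text{ entering } v:\tau(a)\le i\}$, $\delta_N^i(v)=\{a\text{ leaving } v:\tau(a)\le i\}$; $N$ is pre-flow if $|\rho_N^i(v)|\ge|\delta_N^i(v)|$ for all $i\in\mathbb{N}$, $v\in V$. $N$ is consistent if any two arcs lying in the same strongly connected component of $D$ have the same $\tau$-value. A directed path with arcs $a_1,\dots,a_\ell$ in order is $\tau$-respecting if $\tau(a_1)\le\dots\le\tau(a_\ell)$; $\lambda_N(s,v)$ is the maximum number of pairwise arc-disjoint $\tau$-respecting $(s,v)$-paths. An $s$-arborescence is an acyclic subgraph $F=(V'\cup\{s\},A')$, $V'\subseteq V$, in which each vertex of $V'$ has in-degree exactly $1$ (not necessarily spanning); it is $\tau$-respecting if for each of its vertices $v$ the unique $(s,v)$-path in $F$ is $\tau$-respecting. *)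

theory Defs
  imports Main
begin

text \<open>A temporal network N = (D, tau) is given by a finite vertex set V, a root s
  not in V, a finite set A of arc identifiers (so parallel arcs are allowed),
  maps src/tgt giving the tail and head of each arc, and a time labelling tau.
  No arc enters s.\<close>

definition temporal_network ::
  "'v set \<Rightarrow> 'v \<Rightarrow> 'e set \<Rightarrow> ('e \<Rightarrow> 'v) \<Rightarrow> ('e \<Rightarrow> 'v) \<Rightarrow> bool" where
  "temporal_network V s A src tgt \<longleftrightarrow>
     finite V \<and> finite A \<and> s \<notin> V \<and>
     (\<forall>a\<in>A. src a \<in> V \<union> {s} \<and> tgt a \<in> V)"

definition out_degree :: "'e set \<Rightarrow> ('e \<Rightarrow> 'v) \<Rightarrow> 'v \<Rightarrow> nat" where
  "out_degree A src v = card {a\<in>A. src a = v}"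

definition pre_flow ::
  "'v set \<Rightarrow> 'e set \<Rightarrow> ('e \<Rightarrow> 'v) \<Rightarrow> ('e \<Rightarrow> 'v) \<Rightarrow> ('e \<Rightarrow> nat) \<Rightarrow> bool" where
  "pre_flow V A src tgt tau \<longleftrightarrow>
     (\<forall>i::nat. \<forall>v\<in>V.
        card {a\<in>A. tgt a = v \<and> tau a \<le> i} \<ge> card {a\<in>A. src a = v \<and> tau a \<le> i})"

definition arc_rel :: "'e set \<Rightarrow> ('e \<Rightarrow> 'v) \<Rightarrow> ('e \<Rightarrow> 'v) \<Rightarrow> ('v \<times> 'v) set" where
  "arc_rel A src tgt = {(src a, tgt a) | a. a \<in> A}"

definition strongly_conn :: "'e set \<Rightarrow> ('e \<Rightarrow> 'v) \<Rightarrow> ('e \<Rightarrow> 'v) \<Rightarrow> 'v \<Rightarrow> 'v \<Rightarrow> bool" where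
  "strongly_conn A src tgt u w \<longleftrightarrow>
     (u, w) \<in> (arc_rel A src tgt)\<^sup>* \<and> (w, u) \<in> (arc_rel A src tgt)\<^sup>*"

definition consistent ::
  "'e set \<Rightarrow> ('e \<Rightarrow> 'v) \<Rightarrow> ('e \<Rightarrow> 'v) \<Rightarrow> ('e \<Rightarrow> nat) \<Rightarrow> bool" where
  "consistent A src tgt tau \<longleftrightarrow>
     (\<forall>a\<in>A. \<forall>b\<in>A.
        strongly_conn A src tgt (src a) (tgt a) \<and> strongly_conn A src tgt (src b) (tgt b) \<and>
        strongly_conn A src tgt (src a) (src b) \<longrightarrow> tau a = tau b)"

definition is_path ::
  "'e set \<Rightarrow> ('e \<Rightarrow> 'v) \<Rightarrow> ('e \<Rightarrow> 'v) \<Rightarrow> 'v \<Rightarrow> 'v \<Rightarrow> 'e list \<Rightarrow> bool" where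
  "is_path B src tgt u v es \<longleftrightarrow>
     es \<noteq> [] \<and> set es \<subseteq> B \<and> src (hd es) = u \<and> tgt (last es) = v \<and>
     (\<forall>i. Suc i < length es \<longrightarrow> tgt (es ! i) = src (es ! Suc i)) \<and>
     distinct (map src es @ [v])"

definition tau_respecting :: "('e \<Rightarrow> nat) \<Rightarrow> 'e list \<Rightarrow> bool" where
  "tau_respecting tau es \<longleftrightarrow> sorted (map tau es)"

definition lambda_N ::
  "'e set \<Rightarrow> ('e \<Rightarrow> 'v) \<Rightarrow> ('e \<Rightarrow> 'v) \<Rightarrow> ('e \<Rightarrow> nat) \<Rightarrow> 'v \<Rightarrow> 'v \<Rightarrow> nat" where
  "lambda_N A src tgt tau s v =
     Max {k. \<exists>ps :: 'e list list. length ps = k \<and>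
               (\<forall>p\<in>set ps. is_path A src tgt s v p \<and> tau_respecting tau p) \<and>
               (\<forall>i<k. \<forall>j<k. i \<noteq> j \<longrightarrow> set (ps ! i) \<inter> set (ps ! j) = {})}"

text \<open>An s-arborescence F = (V' \<union> {s}, A') with V' \<subseteq> V, A' \<subseteq> A: all arcs of A'
  have endpoints in V' \<union> {s}, F is acyclic, and every vertex of V' has in-degree
  exactly 1 in F.  (No arc enters s, so s has in-degree 0.)\<close>
definition s_arborescence ::
  "'v set \<Rightarrow> 'v \<Rightarrow> 'e set \<Rightarrow> ('e \<Rightarrow> 'v) \<Rightarrow> ('e \<Rightarrow> 'v) \<Rightarrow> 'v set \<Rightarrow> 'e set \<Rightarrow> bool" where
  "s_arborescence V s A src tgt V' A' \<longleftrightarrow>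
     V' \<subseteq> V \<and> A' \<subseteq> A \<and>
     (\<forall>a\<in>A'. src a \<in> V' \<union> {s} \<and> tgt a \<in> V' \<union> {s}) \<and>
     acyclic (arc_rel A' src tgt) \<and>
     (\<forall>v\<in>V'. card {a\<in>A'. tgt a = v} = 1)"

text \<open>tau-respecting arborescence: for each vertex v of F (other than s), the
  unique (s,v)-path in F is tau-respecting.\<close>
definition tau_respecting_arborescence ::
  "'v set \<Rightarrow> 'v \<Rightarrow> 'e set \<Rightarrow> ('e \<Rightarrow> 'v) \<Rightarrow> ('e \<Rightarrow> 'v) \<Rightarrow> ('e \<Rightarrow> nat) \<Rightarrow> 'v set \<Rightarrow> 'e set \<Rightarrow> bool" where
  "tau_respecting_arborescence V s A src tgt tau V' A' \<longleftrightarrow>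
     s_arborescence V s A src tgt V' A' \<and>
     (\<forall>v\<in>V'. \<forall>es. is_path A' src tgt s v es \<longrightarrow> tau_respecting tau es)"

end

theory Submission
  imports Defs
begin

text \<open>
  The pre-flow condition allows to match, at every vertex, the leaving arcs injectively with entering
  arcs that are not later. Strongly connected components are treated in topological order, and every arc
  is coloured by one of the arcs leaving \<open>s\<close> such that all arcs leaving the part treated so far are
  reached by a time-respecting path of their colour and have pairwise distinct colours; by the matching
  there are never too many of them. Hence each component \<open>C\<close> gives a local problem in which the
  entering arcs are independent roots, and all inner arcs have the same time \<open>t\<close>.

  The local problem is static. It is solved as in the theorem of Bang-Jensen, Frank and Jackson: split
  off a vertex with minimum demand, preserving all cut demands of the other vertices, apply
  induction, and finally recolour superfluous arcs entering that vertex. The arcs leaving \<open>C\<close>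
  are directed to a sink whose demand forces them to have distinct colours. An arc leaving \<open>C\<close> before
  time \<open>t\<close> can only follow the entering arc \<open>e\<close> matched with it; giving the root \<open>e\<close> a second arc to
  the sink models this, and it leaves the uncrossing inequalities valid.
\<close>

subsection \<open>Splitting off in rooted pre-flow digraphs\<close>

text \<open>Time-respecting walks do not compose: which arcs may follow depends on the time of
  arrival, so static cuts do not describe the whole network. Inside one component consistency fixes
  the time, and a cut function becomes usable. Digraph cuts always satisfy the inequality for
  intersection and union. Splitting off also needs the one for the two differences, and it is the
  pre-flow condition that pays for it. No min-max theorem for \<open>lambda_N\<close> enters; the
  value is squeezed. A minimum cut gives a set of arcs meeting every time-respecting path, and the
  colouring supplies that many colours; conversely, trees of different colours contain disjoint
  paths. Demands inside a component are therefore minimum cut values and not path numbers.\<close>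

text \<open>
  Every root \<open>e \<in> R\<close> is the start of one future tree: it has an arc to \<open>h e\<close>, and if \<open>e \<in> E\<close> a second
  arc to the sink \<open>x\<close>. In the cut value of \<open>X\<close> such a root counts at most once.
\<close>

definition incut ::
  "'b set \<Rightarrow> ('b \<Rightarrow> 'v) \<Rightarrow> ('b \<Rightarrow> 'v) \<Rightarrow> 'r set \<Rightarrow> ('r \<Rightarrow> 'v) \<Rightarrow> 'r set \<Rightarrow> 'v \<Rightarrow> 'v set \<Rightarrow> int" where
  "incut B src tgt R h E x X =
     (\<Sum>b\<in>B. of_bool (src b \<notin> X \<and> tgt b \<in> X)) + (\<Sum>e\<in>R. of_bool (h e \<in> X \<or> e \<in> E \<and> x \<in> X))"

text \<open>
  A colouring assigns every arc to a root; \<open>e\<close> reaches a vertex through arcs of its own colour only.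
  In-degrees are not bounded: trees are extracted from the reached sets at the very end.
\<close>

inductive_set reach ::
  "'b set \<Rightarrow> ('b \<Rightarrow> 'v) \<Rightarrow> ('b \<Rightarrow> 'v) \<Rightarrow> ('r \<Rightarrow> 'v) \<Rightarrow> 'r set \<Rightarrow> 'v \<Rightarrow> ('b \<Rightarrow> 'r) \<Rightarrow> 'r \<Rightarrow> 'v set"
  for B src tgt h E x col e where
  root: "h e \<in> reach B src tgt h E x col e"
| sink: "e \<in> E \<Longrightarrow> x \<in> reach B src tgt h E x col e"
| step: "b \<in> B \<Longrightarrow> col b = e \<Longrightarrow> src b \<in> reach B src tgt h E x col e \<Longrightarrow>
    tgt b \<in> reach B src tgt h E x col e"

lemma sum_of_bool_card:
  "finite A \<Longrightarrow> (\<Sum>a\<in>A. of_bool (P a) :: int) = int (card {a \<in> A. P a})"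
  by (simp add: Int_def)

lemma sum_of_bool_eq_and:
  assumes "finite B" "b0 \<in> B"
  shows "(\<Sum>b\<in>B. of_bool (b = b0 \<and> P) :: int) = of_bool P"
  using assms by (cases P) simp_all

text \<open>The static form of the pre-flow condition. Loops are allowed, since splitting can create
  them. Roots stay in \<open>R\<close> when the vertex \<open>h e\<close> is removed, so
  \<open>h e\<close> may lie outside \<open>U\<close>.\<close>

locale rooted_preflow =
  fixes U :: "'v set" and x :: 'v and B :: "'b set" and src tgt :: "'b \<Rightarrow> 'v"
    and R :: "'r set" and h :: "'r \<Rightarrow> 'v"
  assumes finite_U: "finite U" and finite_B: "finite B" and finite_R: "finite R"
    and x_in: "x \<in> U"
    and src_in: "b \<in> B \<Longrightarrow> src b \<in> U - {x}"
    and tgt_in: "b \<in> B \<Longrightarrow> tgt b \<in> U"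
    and excess: "u \<in> U \<Longrightarrow> (\<Sum>b\<in>B. of_bool (src b = u) :: int) \<le>
      (\<Sum>b\<in>B. of_bool (tgt b = u)) + (\<Sum>e\<in>R. of_bool (h e = u))"
begin

section \<open>Uncrossing inequalities and the effect of a split on cuts\<close>

lemma excess_set:
  assumes "Z \<subseteq> U"
  shows "(\<Sum>b\<in>B. of_bool (src b \<in> Z) :: int) \<le>
      (\<Sum>b\<in>B. of_bool (tgt b \<in> Z)) + (\<Sum>e\<in>R. of_bool (h e \<in> Z))"
proof -
  have fin: "finite Z" using assms finite_U finite_subset by blast
  have one: "(of_bool (y \<in> Z) :: int) = (\<Sum>u\<in>Z. of_bool (y = u))" for y
    using fin by (simp add: of_bool_def sum.delta)
  have "(\<Sum>u\<in>Z. \<Sum>b\<in>B. of_bool (src b = u) :: int) \<le>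
      (\<Sum>u\<in>Z. (\<Sum>b\<in>B. of_bool (tgt b = u)) + (\<Sum>e\<in>R. of_bool (h e = u)))"
    using assms by (intro sum_mono excess) auto
  then show ?thesis
    unfolding one sum.distrib by (subst sum.swap, subst (2) sum.swap, subst (3) sum.swap) simp
qed

text \<open>Submodularity, arc by arc; an arc from \<open>Y - X\<close> to \<open>X - Y\<close> is
  counted on the right only. A root counts when the set meets one or two fixed vertices, which is
  submodular as well.\<close>

lemma incut_inter_union:
  assumes "b0 \<in> B"
  shows "incut B src tgt R h E x (X \<inter> Y) + incut B src tgt R h E x (X \<union> Y)
      + of_bool (src b0 \<in> Y - X \<and> tgt b0 \<in> X - Y)
    \<le> incut B src tgt R h E x X + incut B src tgt R h E x Y"
proof -
  have "(\<Sum>b\<in>B. of_bool (src b \<notin> X \<inter> Y \<and> tgt b \<in> X \<inter> Y) + of_bool (src b \<notin> X \<union> Y \<and> tgt b \<in> X \<union> Y)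
        + of_bool (b = b0 \<and> src b0 \<in> Y - X \<and> tgt b0 \<in> X - Y) :: int)
    \<le> (\<Sum>b\<in>B. of_bool (src b \<notin> X \<and> tgt b \<in> X) + of_bool (src b \<notin> Y \<and> tgt b \<in> Y))"
    by (intro sum_mono) (auto simp: of_bool_def)
  moreover have "(\<Sum>e\<in>R. of_bool (h e \<in> X \<inter> Y \<or> e \<in> E \<and> x \<in> X \<inter> Y)
      + of_bool (h e \<in> X \<union> Y \<or> e \<in> E \<and> x \<in> X \<union> Y) :: int)
    \<le> (\<Sum>e\<in>R. of_bool (h e \<in> X \<or> e \<in> E \<and> x \<in> X) + of_bool (h e \<in> Y \<or> e \<in> E \<and> x \<in> Y))"
    by (intro sum_mono) (auto simp: of_bool_def)
  moreover have "(\<Sum>b\<in>B. of_bool (b = b0 \<and> src b0 \<in> Y - X \<and> tgt b0 \<in> X - Y) :: int)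
      = of_bool (src b0 \<in> Y - X \<and> tgt b0 \<in> X - Y)"
    using assms finite_B by (intro sum_of_bool_eq_and)
  ultimately show ?thesis
    unfolding incut_def sum.distrib by linarith
qed

text \<open>An arc from \<open>X \<inter> Y\<close> into a difference counts on the left but not on
  the right. \<open>excess_set\<close> for \<open>X \<inter> Y\<close> pays for it with the arcs and
  roots entering there, each counted at least once more on the right than on the left.\<close>

lemma incut_diff_diff:
  assumes "X \<subseteq> U" "Y \<subseteq> U" "b0 \<in> B"
  shows "incut B src tgt R h E x (X - Y) + incut B src tgt R h E x (Y - X)
      + of_bool (src b0 \<in> X \<inter> Y \<and> tgt b0 \<notin> X \<union> Y \<or> src b0 \<notin> X \<union> Y \<and> tgt b0 \<in> X \<inter> Y)
    \<le> incut B src tgt R h E x X + incut B src tgt R h E x Y"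
proof -
  have "(\<Sum>b\<in>B. of_bool (src b \<notin> X - Y \<and> tgt b \<in> X - Y) + of_bool (src b \<notin> Y - X \<and> tgt b \<in> Y - X)
        + of_bool (tgt b \<in> X \<inter> Y) + of_bool (b = b0 \<and> (src b0 \<in> X \<inter> Y \<and> tgt b0 \<notin> X \<union> Y \<or> src b0 \<notin> X \<union> Y \<and> tgt b0 \<in> X \<inter> Y)) :: int)
    \<le> (\<Sum>b\<in>B. of_bool (src b \<notin> X \<and> tgt b \<in> X) + of_bool (src b \<notin> Y \<and> tgt b \<in> Y) + of_bool (src b \<in> X \<inter> Y))"
    by (intro sum_mono) (auto simp: of_bool_def)
  moreover have "(\<Sum>e\<in>R. of_bool (h e \<in> X - Y \<or> e \<in> E \<and> x \<in> X - Y)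
      + of_bool (h e \<in> Y - X \<or> e \<in> E \<and> x \<in> Y - X) + of_bool (h e \<in> X \<inter> Y) :: int)
    \<le> (\<Sum>e\<in>R. of_bool (h e \<in> X \<or> e \<in> E \<and> x \<in> X) + of_bool (h e \<in> Y \<or> e \<in> E \<and> x \<in> Y))"
    by (intro sum_mono) (auto simp: of_bool_def)
  moreover have "(\<Sum>b\<in>B. of_bool (b = b0 \<and> (src b0 \<in> X \<inter> Y \<and> tgt b0 \<notin> X \<union> Y \<or> src b0 \<notin> X \<union> Y \<and> tgt b0 \<in> X \<inter> Y)) :: int)
      = of_bool (src b0 \<in> X \<inter> Y \<and> tgt b0 \<notin> X \<union> Y \<or> src b0 \<notin> X \<union> Y \<and> tgt b0 \<in> X \<inter> Y)"
    using assms finite_B by (intro sum_of_bool_eq_and)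
  moreover have "(\<Sum>b\<in>B. of_bool (src b \<in> X \<inter> Y) :: int) \<le>
      (\<Sum>b\<in>B. of_bool (tgt b \<in> X \<inter> Y)) + (\<Sum>e\<in>R. of_bool (h e \<in> X \<inter> Y))"
    using assms by (intro excess_set) auto
  ultimately show ?thesis
    unfolding incut_def sum.distrib by linarith
qed

text \<open>The arcs \<open>a\<close> and \<open>b0\<close> are merged: \<open>b0\<close> survives
  with the tail of \<open>a\<close>, so heads never change. Only cuts with \<open>v\<close> on one
  side and both other ends on the other side lose a unit.\<close>

lemma incut_split_arc:
  assumes "a \<in> B" "b0 \<in> B" "src b0 = v" "tgt a = v" "tgt b0 \<noteq> v"
  shows "incut B src tgt R h E x X \<le> incut (B - {a}) (src(b0 := src a)) tgt R h E x X
    + of_bool (v \<notin> X \<and> tgt b0 \<in> X \<and> src a \<in> X \<or> v \<in> X \<and> tgt b0 \<notin> X \<and> src a \<notin> X)"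
proof -
  have ne: "a \<noteq> b0" using assms by auto
  have B: "B = insert a (insert b0 (B - {a, b0}))" "B - {a} = insert b0 (B - {a, b0})"
    using assms ne by auto
  have f: "finite (B - {a, b0})" using finite_B by auto
  have rest: "(\<Sum>b\<in>B - {a, b0}. of_bool ((src(b0 := src a)) b \<notin> X \<and> tgt b \<in> X) :: int)
    = (\<Sum>b\<in>B - {a, b0}. of_bool (src b \<notin> X \<and> tgt b \<in> X))"
    by (intro sum.cong) auto
  have 1: "(\<Sum>b\<in>B. of_bool (src b \<notin> X \<and> tgt b \<in> X) :: int) = of_bool (src a \<notin> X \<and> v \<in> X)
    + of_bool (v \<notin> X \<and> tgt b0 \<in> X) + (\<Sum>b\<in>B - {a, b0}. of_bool (src b \<notin> X \<and> tgt b \<in> X))"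
    using assms ne f by (subst B(1)) auto
  have 2: "(\<Sum>b\<in>B - {a}. of_bool ((src(b0 := src a)) b \<notin> X \<and> tgt b \<in> X) :: int) =
    of_bool (src a \<notin> X \<and> tgt b0 \<in> X) + (\<Sum>b\<in>B - {a, b0}. of_bool (src b \<notin> X \<and> tgt b \<in> X))"
    unfolding B(2) using sum.insert[OF f, of b0 "\<lambda>b. of_bool ((src(b0 := src a)) b \<notin> X \<and> tgt b \<in> X) :: int"]
    unfolding rest by simp
  show ?thesis
    unfolding incut_def 1 2 by (auto simp: of_bool_def)
qed

text \<open>The root is merged with \<open>b0\<close>. As to blocking sets, it acts like an in-arc
  of \<open>v\<close> with tail \<open>x\<close> if \<open>e \<in> E\<close>, and with a tail
  outside every set otherwise.\<close>

lemma incut_split_root: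
  assumes "e \<in> R" "b0 \<in> B" "src b0 = v" "h e = v" "tgt b0 \<noteq> v"
  shows "incut B src tgt R h E x X \<le> incut (B - {b0}) src tgt R (h(e := tgt b0)) E x X
    + of_bool (v \<notin> X \<and> tgt b0 \<in> X \<and> (e \<in> E \<and> x \<in> X) \<or> v \<in> X \<and> tgt b0 \<notin> X \<and> \<not> (e \<in> E \<and> x \<in> X))"
proof -
  have rest: "(\<Sum>e'\<in>R - {e}. of_bool ((h(e := tgt b0)) e' \<in> X \<or> e' \<in> E \<and> x \<in> X) :: int)
    = (\<Sum>e'\<in>R - {e}. of_bool (h e' \<in> X \<or> e' \<in> E \<and> x \<in> X))"
    by (intro sum.cong) auto
  have 1: "(\<Sum>b\<in>B. of_bool (src b \<notin> X \<and> tgt b \<in> X) :: int) =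
    of_bool (v \<notin> X \<and> tgt b0 \<in> X) + (\<Sum>b\<in>B - {b0}. of_bool (src b \<notin> X \<and> tgt b \<in> X))"
    using assms finite_B by (subst sum.remove[of _ b0]) auto
  have 2: "(\<Sum>e'\<in>R. of_bool (h e' \<in> X \<or> e' \<in> E \<and> x \<in> X) :: int) = of_bool (v \<in> X \<or> e \<in> E \<and> x \<in> X)
    + (\<Sum>e'\<in>R - {e}. of_bool (h e' \<in> X \<or> e' \<in> E \<and> x \<in> X))"
    using assms finite_R by (subst sum.remove[of _ e]) auto
  have 3: "(\<Sum>e'\<in>R. of_bool ((h(e := tgt b0)) e' \<in> X \<or> e' \<in> E \<and> x \<in> X) :: int) =
    of_bool (tgt b0 \<in> X \<or> e \<in> E \<and> x \<in> X)
    + (\<Sum>e'\<in>R - {e}. of_bool (h e' \<in> X \<or> e' \<in> E \<and> x \<in> X))"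
    using assms finite_R rest by (subst sum.remove[of _ e]) auto
  show ?thesis
    unfolding incut_def 1 2 3 by (auto simp: of_bool_def)
qed

text \<open>
  If every in-arc of \<open>v\<close> were blocked by a tight set, then uncrossing yields a largest tight set
  containing the head of \<open>b0\<close> but not \<open>v\<close>, and a smallest one containing \<open>v\<close> but not that head;
  the arc \<open>b0\<close> makes the respective inequalities strict, and adding or removing \<open>v\<close> violates a demand.
\<close>

lemma splitting_off:
  assumes dem: "\<And>X u. X \<subseteq> U \<Longrightarrow> u \<in> X \<Longrightarrow> u \<noteq> v \<Longrightarrow> l u \<le> incut B src tgt R h E x X"
    and b0: "b0 \<in> B" "src b0 = v" "tgt b0 \<noteq> v"
  shows "(\<exists>a\<in>B. tgt a = v \<and> src a \<noteq> v \<and>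
        (\<forall>X u. X \<subseteq> U \<longrightarrow> u \<in> X \<longrightarrow> u \<noteq> v \<longrightarrow> l u \<le> incut (B - {a}) (src(b0 := src a)) tgt R h E x X)) \<or>
    (\<exists>e\<in>R. h e = v \<and>
        (\<forall>X u. X \<subseteq> U \<longrightarrow> u \<in> X \<longrightarrow> u \<noteq> v \<longrightarrow> l u \<le> incut (B - {b0}) src tgt R (h(e := tgt b0)) E x X))"
proof (rule ccontr)
  assume none: "\<not> ?thesis"
  define z where "z = tgt b0"
  have vU: "v \<in> U" using b0 src_in by auto
  let ?c = "incut B src tgt R h E x"
  define T where "T X \<longleftrightarrow> X \<subseteq> U \<and> (\<exists>u\<in>X. u \<noteq> v \<and> ?c X = l u)" for X
  define S1 where "S1 = {X. T X \<and> z \<in> X \<and> v \<notin> X}"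
  define S2 where "S2 = {Y. T Y \<and> v \<in> Y \<and> z \<notin> Y}"
  have TI: "T X" if "X \<subseteq> U" "u \<in> X" "u \<noteq> v" "?c X \<le> l u" for X u
    using dem[OF that(1-3)] that unfolding T_def by auto
  have arcs: "(\<exists>X\<in>S1. src a \<in> X) \<or> (\<exists>Y\<in>S2. src a \<notin> Y)"
    if a: "a \<in> B" "tgt a = v" "src a \<noteq> v" for a
  proof -
    from none a have "\<not> (\<forall>X u. X \<subseteq> U \<longrightarrow> u \<in> X \<longrightarrow> u \<noteq> v \<longrightarrow> l u \<le> incut (B - {a}) (src(b0 := src a)) tgt R h E x X)"
      by blast
    then obtain X u where X: "X \<subseteq> U" "u \<in> X" "u \<noteq> v"
      and lt: "incut (B - {a}) (src(b0 := src a)) tgt R h E x X < l u"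
      by (auto simp: not_le)
    have *: "v \<notin> X \<and> z \<in> X \<and> src a \<in> X \<or> v \<in> X \<and> z \<notin> X \<and> src a \<notin> X"
      using incut_split_arc[OF a(1) b0(1,2) a(2) b0(3), of E X] dem[OF X] lt
      by (auto simp: z_def of_bool_def split: if_splits)
    have "?c X \<le> l u"
      using incut_split_arc[OF a(1) b0(1,2) a(2) b0(3), of E X] lt
      by (auto simp: of_bool_def split: if_splits)
    then have "T X" by (rule TI[OF X])
    then show ?thesis using * by (auto simp: S1_def S2_def)
  qed
  have roots: "(\<exists>X\<in>S1. e \<in> E \<and> x \<in> X) \<or> (\<exists>Y\<in>S2. \<not> (e \<in> E \<and> x \<in> Y))"
    if e: "e \<in> R" "h e = v" for e
  proof -
    from none e have "\<not> (\<forall>X u. X \<subseteq> U \<longrightarrow> u \<in> X \<longrightarrow> u \<noteq> v \<longrightarrow> l u \<le> incut (B - {b0}) src tgt R (h(e := tgt b0)) E x X)"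
      by blast
    then obtain X u where X: "X \<subseteq> U" "u \<in> X" "u \<noteq> v"
      and lt: "incut (B - {b0}) src tgt R (h(e := tgt b0)) E x X < l u"
      by (auto simp: not_le)
    have *: "v \<notin> X \<and> z \<in> X \<and> (e \<in> E \<and> x \<in> X) \<or> v \<in> X \<and> z \<notin> X \<and> \<not> (e \<in> E \<and> x \<in> X)"
      using incut_split_root[OF e(1) b0(1,2) e(2) b0(3), of E X] dem[OF X] lt
      by (auto simp: z_def of_bool_def split: if_splits)
    have "?c X \<le> l u"
      using incut_split_root[OF e(1) b0(1,2) e(2) b0(3), of E X] lt
      by (auto simp: of_bool_def split: if_splits)
    then have "T X" by (rule TI[OF X])
    then show ?thesis using * by (auto simp: S1_def S2_def)
  qed
  have uncross: "T (X \<inter> Y) \<and> T (X \<union> Y)"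
    if XY: "T X" "T Y" and no: "?c (X - Y) + ?c (Y - X) + 1 \<le> ?c X + ?c Y" for X Y
  proof -
    obtain u1 where u1: "u1 \<in> X" "u1 \<noteq> v" "?c X = l u1" using XY by (auto simp: T_def)
    obtain u2 where u2: "u2 \<in> Y" "u2 \<noteq> v" "?c Y = l u2" using XY by (auto simp: T_def)
    have sub: "X \<subseteq> U" "Y \<subseteq> U" using XY by (auto simp: T_def)
    \<comment> \<open>If each witness avoided the other set, the demands on the two differences
      would contradict the slack. So one witness lies in the intersection, and the other serves the
      union.\<close>
    have "u1 \<in> Y \<or> u2 \<in> X"
    proof (rule ccontr)
      assume "\<not> ?thesis"
      then have "l u1 \<le> ?c (X - Y)" "l u2 \<le> ?c (Y - X)"
        using sub u1 u2 by (auto intro!: dem)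
      then show False using no u1 u2 by linarith
    qed
    then show ?thesis
    proof
      assume "u1 \<in> Y"
      then have "l u1 \<le> ?c (X \<inter> Y)" "l u2 \<le> ?c (X \<union> Y)"
        using sub u1 u2 by (auto intro!: dem)
      then have "?c (X \<inter> Y) \<le> l u1" "?c (X \<union> Y) \<le> l u2"
        using incut_inter_union[OF b0(1), of E X Y] u1 u2 by (auto simp: of_bool_def split: if_splits)
      then show ?thesis
        using \<open>u1 \<in> Y\<close> sub u1 u2 TI[of "X \<inter> Y" u1] TI[of "X \<union> Y" u2] by blast
    next
      assume "u2 \<in> X"
      then have "l u2 \<le> ?c (X \<inter> Y)" "l u1 \<le> ?c (X \<union> Y)"
        using sub u1 u2 by (auto intro!: dem)
      then have "?c (X \<inter> Y) \<le> l u2" "?c (X \<union> Y) \<le> l u1"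
        using incut_inter_union[OF b0(1), of E X Y] u1 u2 by (auto simp: of_bool_def split: if_splits)
      then show ?thesis
        using \<open>u2 \<in> X\<close> sub u1 u2 TI[of "X \<inter> Y" u2] TI[of "X \<union> Y" u1] by blast
    qed
  qed
  have S1_union: "X \<union> Y \<in> S1" if "X \<in> S1" "Y \<in> S1" for X Y
  proof -
    \<comment> \<open>\<open>b0\<close> runs from outside the union into the intersection, which
      gives the unit of slack; for \<open>S2\<close> it runs the opposite way.\<close>
    have "?c (X - Y) + ?c (Y - X) + 1 \<le> ?c X + ?c Y"
      using that b0 incut_diff_diff[of X Y b0 E] by (auto simp: S1_def T_def z_def)
    then show ?thesis using uncross[of X Y] that by (auto simp: S1_def)
  qed
  have S2_inter: "X \<inter> Y \<in> S2" if "X \<in> S2" "Y \<in> S2" for X Y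
  proof -
    have "?c (X - Y) + ?c (Y - X) + 1 \<le> ?c X + ?c Y"
      using that b0 incut_diff_diff[of X Y b0 E] by (auto simp: S2_def T_def z_def)
    then show ?thesis using uncross[of X Y] that by (auto simp: S2_def)
  qed
  have S12: "Y - X \<in> S2" if XY: "X \<in> S1" "Y \<in> S2" for X Y
  proof -
    \<comment> \<open>\<open>b0\<close> runs from \<open>Y - X\<close> to \<open>X - Y\<close>, so
      now the slack sits in the other inequality and forces both witnesses into the
      differences.\<close>
    have no: "?c (X \<inter> Y) + ?c (X \<union> Y) + 1 \<le> ?c X + ?c Y"
      using that b0 incut_inter_union[of b0 E X Y] by (auto simp: S1_def S2_def T_def z_def)
    have sub: "X \<subseteq> U" "Y \<subseteq> U" using that by (auto simp: S1_def S2_def T_def)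
    obtain u1 where u1: "u1 \<in> X" "u1 \<noteq> v" "?c X = l u1" using XY by (auto simp: S1_def T_def)
    obtain u2 where u2: "u2 \<in> Y" "u2 \<noteq> v" "?c Y = l u2" using XY by (auto simp: S2_def T_def)
    have "u1 \<notin> Y"
    proof
      assume "u1 \<in> Y"
      then have "l u1 \<le> ?c (X \<inter> Y)" "l u2 \<le> ?c (X \<union> Y)"
        using sub u1 u2 by (auto intro!: dem)
      then show False using no u1 u2 by linarith
    qed
    moreover have "u2 \<notin> X"
    proof
      assume "u2 \<in> X"
      then have "l u2 \<le> ?c (X \<inter> Y)" "l u1 \<le> ?c (X \<union> Y)"
        using sub u1 u2 by (auto intro!: dem)
      then show False using no u1 u2 by linarith
    qed
    ultimately have u: "u1 \<in> X - Y" "u2 \<in> Y - X" using u1 u2 by auto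
    have "l u1 \<le> ?c (X - Y)" using sub u u1 by (auto intro!: dem)
    moreover have "?c (X - Y) + ?c (Y - X) \<le> ?c X + ?c Y"
      using incut_diff_diff[of X Y b0 E] sub b0 by (auto simp: of_bool_def split: if_splits)
    ultimately have "?c (Y - X) \<le> l u2" using u1 u2 by linarith
    then have "T (Y - X)" using sub u u2 by (intro TI[of _ u2]) auto
    then show ?thesis using that by (auto simp: S1_def S2_def)
  qed
  have fin: "finite S1"
    using finite_U by (auto simp: S1_def T_def intro: finite_subset[of _ "Pow U"])
  \<comment> \<open>Loops aside, removing \<open>v\<close> from \<open>Y\<close> loses all arcs and
    roots entering \<open>v\<close> and gains at most the arcs leaving \<open>v\<close> other than
    \<open>b0\<close>. By \<open>excess\<close> the cut value drops.\<close>
  have no_Y: False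
    if Y: "Y \<in> S2"
      and Ya: "\<And>a. a \<in> B \<Longrightarrow> tgt a = v \<Longrightarrow> src a \<noteq> v \<Longrightarrow> src a \<notin> Y"
      and Yr: "\<And>e. e \<in> R \<Longrightarrow> h e = v \<Longrightarrow> \<not> (e \<in> E \<and> x \<in> Y)" for Y
  proof -
    have mem: "v \<in> Y" "z \<notin> Y" "Y \<subseteq> U" using Y by (auto simp: S2_def T_def)
    have "(\<Sum>b\<in>B. of_bool (src b \<notin> Y - {v} \<and> tgt b \<in> Y - {v}) + of_bool (tgt b = v) + of_bool (b = b0) :: int)
      \<le> (\<Sum>b\<in>B. of_bool (src b \<notin> Y \<and> tgt b \<in> Y) + of_bool (src b = v))"
    proof (rule sum_mono)
      fix b assume "b \<in> B"
      then show "of_bool (src b \<notin> Y - {v} \<and> tgt b \<in> Y - {v}) + of_bool (tgt b = v) + of_bool (b = b0)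
          \<le> (of_bool (src b \<notin> Y \<and> tgt b \<in> Y) + of_bool (src b = v) :: int)"
        using mem b0 Ya[of b] unfolding z_def by (cases "b = b0"; cases "tgt b = v"; cases "src b = v") simp_all
    qed
    moreover have "(\<Sum>e\<in>R. of_bool (h e \<in> Y - {v} \<or> e \<in> E \<and> x \<in> Y - {v}) + of_bool (h e = v) :: int)
      \<le> (\<Sum>e\<in>R. of_bool (h e \<in> Y \<or> e \<in> E \<and> x \<in> Y))"
    proof (rule sum_mono)
      fix e assume "e \<in> R"
      then show "of_bool (h e \<in> Y - {v} \<or> e \<in> E \<and> x \<in> Y - {v}) + of_bool (h e = v)
          \<le> (of_bool (h e \<in> Y \<or> e \<in> E \<and> x \<in> Y) :: int)"
        using mem Yr[of e] by (cases "h e = v") auto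
    qed
    moreover have "(\<Sum>b\<in>B. of_bool (b = b0) :: int) = 1"
      using b0 finite_B by (simp add: of_bool_def)
    ultimately have "?c (Y - {v}) + 1 \<le> ?c Y"
      using excess[OF vU] unfolding incut_def sum.distrib by linarith
    moreover obtain u where "u \<in> Y" "u \<noteq> v" "?c Y = l u" using Y by (auto simp: S2_def T_def)
    ultimately show False using dem[of "Y - {v}" u] mem by auto
  qed
  \<comment> \<open>Adding \<open>v\<close> to \<open>X\<close> brings in no new arc or root, while
    \<open>b0\<close> becomes internal.\<close>
  have no_X: False
    if X: "X \<in> S1"
      and Xa: "\<And>a. a \<in> B \<Longrightarrow> tgt a = v \<Longrightarrow> src a \<noteq> v \<Longrightarrow> src a \<in> X"
      and Xr: "\<And>e. e \<in> R \<Longrightarrow> h e = v \<Longrightarrow> e \<in> E \<and> x \<in> X" for X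
  proof -
    have mem: "v \<notin> X" "z \<in> X" "X \<subseteq> U" using X by (auto simp: S1_def T_def)
    have "(\<Sum>b\<in>B. of_bool (src b \<notin> insert v X \<and> tgt b \<in> insert v X) + of_bool (b = b0) :: int)
      \<le> (\<Sum>b\<in>B. of_bool (src b \<notin> X \<and> tgt b \<in> X))"
    proof (rule sum_mono)
      fix b assume "b \<in> B"
      then show "of_bool (src b \<notin> insert v X \<and> tgt b \<in> insert v X) + of_bool (b = b0)
          \<le> (of_bool (src b \<notin> X \<and> tgt b \<in> X) :: int)"
        using mem b0 Xa[of b] unfolding z_def by (cases "b = b0"; cases "tgt b = v"; cases "src b = v") simp_all
    qed
    moreover have "(\<Sum>e\<in>R. of_bool (h e \<in> insert v X \<or> e \<in> E \<and> x \<in> insert v X) :: int)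
      \<le> (\<Sum>e\<in>R. of_bool (h e \<in> X \<or> e \<in> E \<and> x \<in> X))"
    proof (rule sum_mono)
      fix e assume "e \<in> R"
      then show "of_bool (h e \<in> insert v X \<or> e \<in> E \<and> x \<in> insert v X)
          \<le> (of_bool (h e \<in> X \<or> e \<in> E \<and> x \<in> X) :: int)"
        using mem Xr[of e] b0 src_in[of b0] by (cases "h e = v") auto
    qed
    moreover have "(\<Sum>b\<in>B. of_bool (b = b0) :: int) = 1"
      using b0 finite_B by (simp add: of_bool_def)
    ultimately have "?c (insert v X) + 1 \<le> ?c X"
      unfolding incut_def sum.distrib by linarith
    moreover obtain u where "u \<in> X" "u \<noteq> v" "?c X = l u" using X by (auto simp: S1_def T_def)
    ultimately show False using dem[of "insert v X" u] mem vU by auto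
  qed
  show False
  proof (cases "S2 = {}")
    case False
    then obtain Y where Y: "Y \<in> S2" and Ymin: "\<And>Y'. Y' \<in> S2 \<Longrightarrow> card Y \<le> card Y'"
      using ex_has_least_nat[of "\<lambda>Y. Y \<in> S2" _ card] by blast
    have Yfin: "finite Y" using Y finite_U finite_subset by (auto simp: S2_def T_def)
    have Y_sub: "Y \<subseteq> Y'" if "Y' \<in> S2" for Y'
    proof -
      have "Y \<inter> Y' = Y" using Ymin[OF S2_inter[OF Y that]] Yfin by (intro card_seteq) auto
      then show ?thesis by auto
    qed
    \<comment> \<open>Since \<open>Y - X\<close> is in \<open>S2\<close> again, the smallest
      \<open>Y\<close> avoids all of \<open>S1\<close>. Hence both kinds of blocking set put the
      tail outside \<open>Y\<close>, and \<open>S1\<close> has to be examined only if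
      \<open>S2\<close> is empty.\<close>
    have disj: "X \<inter> Y = {}" if "X \<in> S1" for X
      using Y_sub[OF S12[OF that Y]] by auto
    show False
    proof (rule no_Y[OF Y])
      fix a assume "a \<in> B" "tgt a = v" "src a \<noteq> v"
      from arcs[OF this] show "src a \<notin> Y" using Y_sub disj by blast
    next
      fix e assume "e \<in> R" "h e = v"
      from roots[OF this] show "\<not> (e \<in> E \<and> x \<in> Y)" using Y_sub disj by blast
    qed
  next
    case S2: True
    show False
    proof (cases "S1 = {}")
      case False
      then obtain X where X: "X \<in> S1" and Xmax: "\<And>X'. X' \<in> S1 \<Longrightarrow> card X' \<le> card X"
      proof -
        have "Max (card ` S1) \<in> card ` S1" using False fin by (intro Max_in) auto
        then obtain X where "X \<in> S1" "card X = Max (card ` S1)" by auto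
        then show thesis using fin by (intro that[of X]) auto
      qed
      have X_sup: "X' \<subseteq> X" if "X' \<in> S1" for X'
      proof -
        have "finite (X \<union> X')" using S1_union[OF X that] finite_U finite_subset
          by (auto simp: S1_def T_def)
        then have "X = X \<union> X'" using Xmax[OF S1_union[OF X that]] by (intro card_seteq) auto
        then show ?thesis by auto
      qed
      show False
      proof (rule no_X[OF X])
        fix a assume "a \<in> B" "tgt a = v" "src a \<noteq> v"
        from arcs[OF this] show "src a \<in> X" using X_sup S2 by blast
      next
        fix e assume "e \<in> R" "h e = v"
        from roots[OF this] show "e \<in> E \<and> x \<in> X" using X_sup S2 by blast
      qed
    next
      case True
      \<comment> \<open>With no blocking set, nothing but loops enters \<open>v\<close>, yet
        \<open>b0\<close> leaves it.\<close>
      have "(\<Sum>b\<in>B. of_bool (tgt b = v) + of_bool (b = b0) :: int) \<le> (\<Sum>b\<in>B. of_bool (src b = v))"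
        using arcs True S2 b0 by (intro sum_mono) (auto simp: of_bool_def)
      moreover have "(\<Sum>e\<in>R. of_bool (h e = v) :: int) = 0"
        using roots True S2 by (intro sum.neutral) auto
      moreover have "(\<Sum>b\<in>B. of_bool (b = b0) :: int) = 1"
        using b0 finite_B by (simp add: of_bool_def)
      ultimately show False
        using excess[OF vU] unfolding sum.distrib by linarith
    qed
  qed
qed

end

subsection \<open>Colourings meeting all cut demands\<close>

text \<open>Compares two different digraphs: the larger reached set only has to be closed under the
  moves of the other. This lets a merged arc be simulated by two original ones.\<close>

lemma reach_mono:
  assumes "\<And>w. w \<in> {h' e} \<union> {w. e \<in> E' \<and> w = x'} \<Longrightarrow> w \<in> reach B src tgt h E x col e"
    and "\<And>b. b \<in> B' \<Longrightarrow> col' b = e \<Longrightarrow> src' b \<in> reach B src tgt h E x col e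
      \<Longrightarrow> tgt' b \<in> reach B src tgt h E x col e"
  shows "reach B' src' tgt' h' E' x' col' e \<subseteq> reach B src tgt h E x col e"
proof
  fix w assume "w \<in> reach B' src' tgt' h' E' x' col' e"
  then show "w \<in> reach B src tgt h E x col e"
    by induction (use assms in auto)
qed

context rooted_preflow
begin

text \<open>
  Each colour at \<open>v\<close> keeps one anchor, an in-arc whose tail it reaches without passing through \<open>v\<close>. Any
  other in-arc can be recoloured without loss.
\<close>

lemma recolour:
  assumes v: "v \<in> U" "v \<noteq> x"
    and deg: "int (card {e \<in> R. v \<in> reach B src tgt h E x col e}) < incut B src tgt R h E x {v}"
    and nbr: "\<And>a. a \<in> B \<Longrightarrow> tgt a = v \<Longrightarrow> src a \<noteq> v \<Longrightarrow>
      card {e \<in> R. v \<in> reach B src tgt h E x col e} < card {e \<in> R. src a \<in> reach B src tgt h E x col e}"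
  shows "\<exists>col'. (\<forall>e\<in>R. reach B src tgt h E x col e \<subseteq> reach B src tgt h E x col' e) \<and>
    (\<exists>e\<in>R. v \<in> reach B src tgt h E x col' e \<and> v \<notin> reach B src tgt h E x col e)"
proof -
  let ?r = "\<lambda>c e. reach B src tgt h E x c e"
  define J where "J = {e \<in> R. v \<in> ?r col e}"
  define Q where "Q = {e \<in> R. h e = v}"
  define I where "I = {a \<in> B. tgt a = v \<and> src a \<noteq> v}"
  have fin: "finite J" "finite Q" "finite I" using finite_R finite_B by (auto simp: J_def Q_def I_def)
  have QJ: "Q \<subseteq> J" by (auto simp: Q_def J_def intro: reach.root)
  \<comment> \<open>What colour \<open>e\<close> reaches without any arc into \<open>v\<close> stays
    reached however the in-arcs of \<open>v\<close> are recoloured.\<close>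
  define N where "N = (\<lambda>e. reach {b \<in> B. tgt b \<noteq> v} src tgt h E x col e)"
  have anchor: "\<exists>a\<in>I. col a = e \<and> src a \<in> N e" if e: "e \<in> J - Q" for e
  proof (rule ccontr)
    assume no: "\<not> ?thesis"
    have "?r col e \<subseteq> N e - {v}"
    proof
      fix w assume "w \<in> ?r col e"
      then show "w \<in> N e - {v}"
      proof induction
        case root
        then show ?case using e by (auto simp: N_def Q_def J_def intro: reach.root)
      next
        case sink
        then show ?case using v by (auto simp: N_def intro: reach.sink)
      next
        case (step b)
        have "tgt b \<noteq> v" using step no by (auto simp: I_def)
        then show ?case using step by (auto simp: N_def intro: reach.step)
      qed
    qed
    then show False using e by (auto simp: J_def)
  qed
  then obtain \<alpha> where \<alpha>: "\<And>e. e \<in> J - Q \<Longrightarrow> \<alpha> e \<in> I \<and> col (\<alpha> e) = e \<and> src (\<alpha> e) \<in> N e"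
    by metis
  have "incut B src tgt R h E x {v} = int (card I) + int (card Q)"
    unfolding incut_def I_def Q_def using finite_B finite_R v
    by (auto simp: Int_def intro!: arg_cong[where f = card])
  then have "card J < card I + card Q" using deg by (simp add: J_def)
  then have "card (J - Q) < card I" using card_mono[OF fin(1) QJ] card_Diff_subset[OF fin(2) QJ] by linarith
  then have "card (\<alpha> ` (J - Q)) < card I" using card_image_le[of "J - Q" \<alpha>] fin(1) by (meson finite_Diff le_less_trans)
  then obtain a where a: "a \<in> I" "a \<notin> \<alpha> ` (J - Q)"
    by (metis card_mono fin(1) finite_Diff finite_imageI not_le subsetI)
  then have aB: "a \<in> B" "tgt a = v" "src a \<noteq> v" by (auto simp: I_def)
  \<comment> \<open>More colours reach the tail of \<open>a\<close> than reach \<open>v\<close>, so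
    \<open>a\<close> can bring a new one to \<open>v\<close>.\<close>
  obtain j where j: "j \<in> R" "src a \<in> ?r col j" "j \<notin> J"
  proof -
    have "\<not> {e \<in> R. src a \<in> ?r col e} \<subseteq> J"
      using nbr[OF aB] card_mono[OF fin(1)] unfolding J_def[symmetric] by (meson not_le)
    then show thesis using that by auto
  qed
  define col' where "col' = col(a := j)"
  have sub: "?r col e \<subseteq> ?r col' e" if "e \<in> R" for e
  proof (cases "e = col a \<and> v \<in> ?r col e")
    case False
    show ?thesis
    proof
      fix w assume "w \<in> ?r col e"
      then show "w \<in> ?r col' e"
      proof induction
        case (step b)
        then have "b \<noteq> a" using False aB by (metis reach.step)
        then show ?case using step by (auto simp: col'_def intro: reach.step)
      qed (auto intro: reach.intros)
    qed
  next
    case True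
    have N_sub': "N e \<subseteq> ?r col' e"
      unfolding N_def using aB by (intro reach_mono) (auto simp: col'_def intro: reach.intros)
    have v': "v \<in> ?r col' e"
    proof (cases "h e = v")
      case True then show ?thesis by (metis reach.root)
    next
      case False
      then have e: "e \<in> J - Q" using True \<open>e \<in> R\<close> by (auto simp: J_def Q_def)
      then have "\<alpha> e \<noteq> a" using a by auto
      then show ?thesis
        using \<alpha>[OF e] N_sub' reach.step[of "\<alpha> e" B col' e src tgt h E x] by (auto simp: I_def col'_def)
    qed
    show ?thesis
    proof
      fix w assume "w \<in> ?r col e"
      then show "w \<in> ?r col' e"
      proof induction
        case (step b)
        then show ?case
        proof (cases "b = a")
          case False
          then show ?thesis using step by (auto simp: col'_def intro: reach.step)
        qed (use v' aB in auto)
      qed (auto intro: reach.intros)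
    qed
  qed
  have "src a \<in> ?r col' j" using sub[OF j(1)] j(2) by blast
  then have "v \<in> ?r col' j"
    using reach.step[of a B col' j src tgt h E x] aB by (simp add: col'_def)
  moreover have "v \<notin> ?r col j" using j by (simp add: J_def)
  ultimately show ?thesis using sub j(1) by blast
qed

text \<open>\<open>recolour\<close> is iterated on the deficit at \<open>v\<close>. Its hypotheses
  persist, because reached sets only grow and \<open>k\<close> exceeds the number of colours at
  \<open>v\<close> until the goal is met.\<close>

lemma saturate:
  assumes v: "v \<in> U" "v \<noteq> x"
    and deg: "k \<le> incut B src tgt R h E x {v}"
    and nbr: "\<And>a. a \<in> B \<Longrightarrow> tgt a = v \<Longrightarrow> src a \<noteq> v \<Longrightarrow>
      k \<le> int (card {e \<in> R. src a \<in> reach B src tgt h E x col e})"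
  shows "\<exists>col'. (\<forall>e\<in>R. reach B src tgt h E x col e \<subseteq> reach B src tgt h E x col' e) \<and>
    k \<le> int (card {e \<in> R. v \<in> reach B src tgt h E x col' e})"
  using nbr
proof (induction "nat (k - int (card {e \<in> R. v \<in> reach B src tgt h E x col e}))" arbitrary: col
    rule: less_induct)
  case less
  let ?r = "\<lambda>c e. reach B src tgt h E x c e"
  show ?case
  proof (cases "k \<le> int (card {e \<in> R. v \<in> ?r col e})")
    case True
    then show ?thesis by auto
  next
    case False
    have "\<exists>col'. (\<forall>e\<in>R. ?r col e \<subseteq> ?r col' e) \<and> (\<exists>e\<in>R. v \<in> ?r col' e \<and> v \<notin> ?r col e)"
    proof (rule recolour[OF v])
      fix a assume "a \<in> B" "tgt a = v" "src a \<noteq> v"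
      from less.prems[OF this] False
      show "card {e \<in> R. v \<in> ?r col e} < card {e \<in> R. src a \<in> ?r col e}" by linarith
    qed (use False deg in linarith)
    then obtain col1 j where col1: "\<And>e. e \<in> R \<Longrightarrow> ?r col e \<subseteq> ?r col1 e"
      and j: "j \<in> R" "v \<in> ?r col1 j" "v \<notin> ?r col j"
      by blast
    have mono: "card {e \<in> R. u \<in> ?r col e} \<le> card {e \<in> R. u \<in> ?r col1 e}" for u
      using col1 finite_R by (intro card_mono) auto
    have "card {e \<in> R. v \<in> ?r col e} < card {e \<in> R. v \<in> ?r col1 e}"
      using col1 j finite_R by (intro psubset_card_mono) auto
    then have "nat (k - int (card {e \<in> R. v \<in> ?r col1 e})) < nat (k - int (card {e \<in> R. v \<in> ?r col e}))"
      using False by linarith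
    moreover have "k \<le> int (card {e \<in> R. src a \<in> ?r col1 e})" if "a \<in> B" "tgt a = v" "src a \<noteq> v" for a
      using less.prems[OF that] mono[of "src a"] by linarith
    ultimately obtain col2 where "\<And>e. e \<in> R \<Longrightarrow> ?r col1 e \<subseteq> ?r col2 e"
      "k \<le> int (card {e \<in> R. v \<in> ?r col2 e})"
      using less.hyps[of col1] by blast
    then show ?thesis using col1 by (intro exI[of _ col2]) blast
  qed
qed

text \<open>At \<open>v\<close> one entering and one leaving arc disappear; the tail of
  \<open>a\<close> trades \<open>a\<close> for \<open>b0\<close>, and all other degrees
  stay.\<close>

lemma rooted_preflow_split_arc:
  assumes "a \<in> B" "b0 \<in> B" "src b0 = v" "tgt a = v" "tgt b0 \<noteq> v"
  shows "rooted_preflow U x (B - {a}) (src(b0 := src a)) tgt R h"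
proof
  fix u assume "u \<in> U"
  have ne: "a \<noteq> b0" using assms by auto
  have f: "finite (B - {a, b0})" using finite_B by auto
  have B: "B = insert a (insert b0 (B - {a, b0}))" "B - {a} = insert b0 (B - {a, b0})"
    using assms ne by auto
  have rest: "(\<Sum>b\<in>B - {a, b0}. of_bool ((src(b0 := src a)) b = u) :: int)
    = (\<Sum>b\<in>B - {a, b0}. of_bool (src b = u))"
    by (intro sum.cong) auto
  have 1: "(\<Sum>b\<in>B. g b) = g a + g b0 + (\<Sum>b\<in>B - {a, b0}. g b)" for g :: "'b \<Rightarrow> int"
    using assms ne f by (subst B(1)) auto
  have 2: "(\<Sum>b\<in>B - {a}. g b) = g b0 + (\<Sum>b\<in>B - {a, b0}. g b)" for g :: "'b \<Rightarrow> int"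
    unfolding B(2) using f by auto
  show "(\<Sum>b\<in>B - {a}. of_bool ((src(b0 := src a)) b = u) :: int)
    \<le> (\<Sum>b\<in>B - {a}. of_bool (tgt b = u)) + (\<Sum>e\<in>R. of_bool (h e = u))"
    using excess[OF \<open>u \<in> U\<close>] assms unfolding 1 2 rest by simp
qed (use finite_U finite_B finite_R x_in src_in[of a] src_in tgt_in assms in \<open>auto split: if_splits\<close>)

lemma rooted_preflow_split_root:
  assumes "e \<in> R" "b0 \<in> B" "src b0 = v" "h e = v" "tgt b0 \<noteq> v"
  shows "rooted_preflow U x (B - {b0}) src tgt R (h(e := tgt b0))"
proof
  fix u assume "u \<in> U"
  have rest: "(\<Sum>e'\<in>R - {e}. of_bool ((h(e := tgt b0)) e' = u) :: int)
    = (\<Sum>e'\<in>R - {e}. of_bool (h e' = u))"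
    by (intro sum.cong) auto
  have 1: "(\<Sum>b\<in>B. g b) = g b0 + (\<Sum>b\<in>B - {b0}. g b)" for g :: "'b \<Rightarrow> int"
    using assms finite_B by (intro sum.remove) auto
  have 2: "(\<Sum>e'\<in>R. g e') = g e + (\<Sum>e'\<in>R - {e}. g e')" for g :: "'r \<Rightarrow> int"
    using assms finite_R by (intro sum.remove) auto
  show "(\<Sum>b\<in>B - {b0}. of_bool (src b = u) :: int)
    \<le> (\<Sum>b\<in>B - {b0}. of_bool (tgt b = u)) + (\<Sum>e'\<in>R. of_bool ((h(e := tgt b0)) e' = u))"
    using excess[OF \<open>u \<in> U\<close>] assms unfolding 1 2 rest by simp
qed (use finite_U finite_B finite_R x_in src_in tgt_in assms in \<open>auto split: if_splits\<close>)

text \<open>When only loops leave \<open>v\<close>, its deletion costs other vertices leaving arcs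
  but no entering ones.\<close>

lemma rooted_preflow_delete:
  assumes "v \<noteq> x" "\<And>b. b \<in> B \<Longrightarrow> src b = v \<Longrightarrow> tgt b = v"
  shows "rooted_preflow (U - {v}) x {b \<in> B. src b \<noteq> v \<and> tgt b \<noteq> v} src tgt R h"
proof
  fix u assume u: "u \<in> U - {v}"
  let ?B = "{b \<in> B. src b \<noteq> v \<and> tgt b \<noteq> v}"
  have 1: "(\<Sum>b\<in>?B. of_bool (src b = u) :: int) \<le> (\<Sum>b\<in>B. of_bool (src b = u))"
    using finite_B by (intro sum_mono2) auto
  have 2: "(\<Sum>b\<in>?B. of_bool (tgt b = u) :: int) = (\<Sum>b\<in>B. of_bool (tgt b = u))"
    using finite_B u assms(2) by (intro sum.mono_neutral_left) auto
  show "(\<Sum>b\<in>?B. of_bool (src b = u) :: int)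
    \<le> (\<Sum>b\<in>?B. of_bool (tgt b = u)) + (\<Sum>e\<in>R. of_bool (h e = u))"
    using excess[of u] u 1 2 by auto
qed (use finite_U finite_B finite_R x_in src_in tgt_in assms(1) in auto)

end

text \<open>Each split consumes a non-loop arc leaving \<open>v\<close>, until \<open>v\<close> can
  be deleted. The induction hypothesis for the smaller vertex set is the assumption
  \<open>IH\<close>, quantified over what splits change; \<open>tgt\<close> and \<open>R\<close>
  stay fixed.\<close>

lemma colouring_off_vertex:
  fixes l :: "'v \<Rightarrow> int" and tgt :: "'b \<Rightarrow> 'v" and R :: "'r set"
  assumes IH: "\<And>B src h. rooted_preflow (U - {v}) x B src tgt R h \<Longrightarrow>
      (\<And>X u. X \<subseteq> U - {v} \<Longrightarrow> u \<in> X \<Longrightarrow> l u \<le> incut B src tgt R h E x X) \<Longrightarrow>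
      \<exists>col. \<forall>u\<in>U - {v}. l u \<le> int (card {e \<in> R. u \<in> reach B src tgt h E x col e})"
    and "v \<noteq> x" and "rooted_preflow U x B src tgt R h"
    and "\<And>X u. X \<subseteq> U \<Longrightarrow> u \<in> X \<Longrightarrow> u \<noteq> v \<Longrightarrow> l u \<le> incut B src tgt R h E x X"
  shows "\<exists>col. \<forall>u\<in>U - {v}. l u \<le> int (card {e \<in> R. u \<in> reach B src tgt h E x col e})"
  using assms(3,4)
proof (induction "card {b \<in> B. src b = v \<and> tgt b \<noteq> v}" arbitrary: B src h rule: less_induct)
  case less
  interpret rooted_preflow U x B src tgt R h by (rule less.prems)
  note dem = less.prems(2)
  have lift: ?case
    if sub: "\<And>e. e \<in> R \<Longrightarrow> reach B' src' tgt h' E x col' e \<subseteq> reach B src tgt h E x col e"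
      and col': "\<forall>u\<in>U - {v}. l u \<le> int (card {e \<in> R. u \<in> reach B' src' tgt h' E x col' e})"
    for B' src' h' col' col
  proof (intro exI ballI)
    fix u assume "u \<in> U - {v}"
    then have "l u \<le> int (card {e \<in> R. u \<in> reach B' src' tgt h' E x col' e})" using col' by auto
    also have "\<dots> \<le> int (card {e \<in> R. u \<in> reach B src tgt h E x col e})"
      using sub finite_R by (auto intro!: card_mono)
    finally show "l u \<le> int (card {e \<in> R. u \<in> reach B src tgt h E x col e})" .
  qed
  show ?case
  proof (cases "\<exists>b0\<in>B. src b0 = v \<and> tgt b0 \<noteq> v")
    case False
    let ?B = "{b \<in> B. src b \<noteq> v \<and> tgt b \<noteq> v}"
    have rp: "rooted_preflow (U - {v}) x ?B src tgt R h"
      using False \<open>v \<noteq> x\<close> by (intro rooted_preflow_delete) auto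
    have "l u \<le> incut ?B src tgt R h E x X" if "X \<subseteq> U - {v}" "u \<in> X" for X u
    proof -
      have "(\<Sum>b\<in>?B. of_bool (src b \<notin> X \<and> tgt b \<in> X) :: int) = (\<Sum>b\<in>B. of_bool (src b \<notin> X \<and> tgt b \<in> X))"
        using finite_B that False by (intro sum.mono_neutral_left) auto
      then show ?thesis using dem[of X u] that unfolding incut_def by auto
    qed
    from IH[OF rp this] obtain col where
      col: "\<forall>u\<in>U - {v}. l u \<le> int (card {e \<in> R. u \<in> reach ?B src tgt h E x col e})" by auto
    show ?thesis
      by (rule lift[OF _ col], rule reach_mono) (auto intro: reach.intros)
  next
    case True
    then obtain b0 where b0: "b0 \<in> B" "src b0 = v" "tgt b0 \<noteq> v" by auto
    from splitting_off[OF dem b0] show ?thesis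
    proof
      assume "\<exists>a\<in>B. tgt a = v \<and> src a \<noteq> v \<and> (\<forall>X u. X \<subseteq> U \<longrightarrow> u \<in> X \<longrightarrow> u \<noteq> v \<longrightarrow>
        l u \<le> incut (B - {a}) (src(b0 := src a)) tgt R h E x X)"
      then obtain a where a: "a \<in> B" "tgt a = v" "src a \<noteq> v" and
        dem': "\<And>X u. X \<subseteq> U \<Longrightarrow> u \<in> X \<Longrightarrow> u \<noteq> v \<Longrightarrow>
          l u \<le> incut (B - {a}) (src(b0 := src a)) tgt R h E x X" by blast
      have rp: "rooted_preflow U x (B - {a}) (src(b0 := src a)) tgt R h"
        using a b0 by (intro rooted_preflow_split_arc)
      have "card {b \<in> B - {a}. (src(b0 := src a)) b = v \<and> tgt b \<noteq> v} < card {b \<in> B. src b = v \<and> tgt b \<noteq> v}"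
        using finite_B a b0 by (intro psubset_card_mono) (auto split: if_splits)
      from less.hyps[OF this rp dem'] obtain col where
        col: "\<forall>u\<in>U - {v}. l u \<le> int (card {e \<in> R. u \<in> reach (B - {a}) (src(b0 := src a)) tgt h E x col e})"
        by blast
      \<comment> \<open>Both original arcs take the colour of the merged one, whose move becomes two
        steps through \<open>v\<close>.\<close>
      define col' where "col' = col(a := col b0)"
      let ?r = "reach B src tgt h E x col'"
      have "a \<noteq> b0" using a b0 by auto
      then have col': "col' a = col b0" "\<And>b. b \<noteq> a \<Longrightarrow> col' b = col b" by (auto simp: col'_def)
      show ?thesis
      proof (rule lift[OF _ col], rule reach_mono)
        fix e b assume b: "b \<in> B - {a}" "col b = e" "(src(b0 := src a)) b \<in> ?r e"
        show "tgt b \<in> ?r e"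
        proof (cases "b = b0")
          case True
          then have "tgt a \<in> ?r e" using b a col' by (intro reach.step) auto
          then show ?thesis using b True b0 a col' by (intro reach.step) auto
        next
          case False
          then show ?thesis using b col' by (intro reach.step) auto
        qed
      qed (auto intro: reach.intros)
    next
      assume "\<exists>e\<in>R. h e = v \<and> (\<forall>X u. X \<subseteq> U \<longrightarrow> u \<in> X \<longrightarrow> u \<noteq> v \<longrightarrow>
        l u \<le> incut (B - {b0}) src tgt R (h(e := tgt b0)) E x X)"
      then obtain e where e: "e \<in> R" "h e = v" and
        dem': "\<And>X u. X \<subseteq> U \<Longrightarrow> u \<in> X \<Longrightarrow> u \<noteq> v \<Longrightarrow>
          l u \<le> incut (B - {b0}) src tgt R (h(e := tgt b0)) E x X" by blast
      have rp: "rooted_preflow U x (B - {b0}) src tgt R (h(e := tgt b0))"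
        using e b0 by (intro rooted_preflow_split_root)
      have "card {b \<in> B - {b0}. src b = v \<and> tgt b \<noteq> v} < card {b \<in> B. src b = v \<and> tgt b \<noteq> v}"
        using finite_B b0 by (intro psubset_card_mono) auto
      from less.hyps[OF this rp dem'] obtain col where
        col: "\<forall>u\<in>U - {v}. l u \<le> int (card {e' \<in> R. u \<in> reach (B - {b0}) src tgt (h(e := tgt b0)) E x col e'})"
        by blast
      \<comment> \<open>The root starts at \<open>v\<close> again, and \<open>b0\<close> in its
        colour leads it to its start after the split.\<close>
      define col' where "col' = col(b0 := e)"
      have col': "col' b0 = e" "\<And>b. b \<noteq> b0 \<Longrightarrow> col' b = col b" by (auto simp: col'_def)
      let ?r = "reach B src tgt h E x col'"
      have "src b0 \<in> ?r e" using b0 e reach.root[of h e] by metis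
      then have "tgt b0 \<in> ?r e" using b0 col' by (intro reach.step) auto
      then show ?thesis
        by (intro lift[OF _ col, where col = col'] reach_mono)
          (auto intro: reach.intros simp: col' split: if_splits)
    qed
  qed
qed

text \<open>
  The vertex \<open>v\<close> that is split off has minimum demand, so afterwards every in-neighbour of \<open>v\<close> is reached
  by at least as many colours as \<open>v\<close> needs.
\<close>

theorem colouring_exists:
  fixes l :: "'v \<Rightarrow> int"
  assumes "rooted_preflow U x B src tgt R h"
    and "\<And>X u. X \<subseteq> U \<Longrightarrow> u \<in> X \<Longrightarrow> l u \<le> incut B src tgt R h E x X"
  shows "\<exists>col. \<forall>u\<in>U. l u \<le> int (card {e \<in> R. u \<in> reach B src tgt h E x col e})"
  using assms
proof (induction "card U" arbitrary: U B src h rule: less_induct)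
  case less
  interpret rooted_preflow U x B src tgt R h by (rule less.prems)
  note dem = less.prems(2)
  show ?case
  proof (cases "U = {x}")
    case True
    have "l x \<le> incut B src tgt R h E x {x}" using dem[of "{x}" x] True by auto
    also have "\<dots> = int (card {e \<in> R. h e = x \<or> e \<in> E})"
    proof -
      have "B = {}" using src_in True by auto
      then show ?thesis
        unfolding incut_def sum_of_bool_card[OF finite_R] by simp
    qed
    also have "\<dots> \<le> int (card {e \<in> R. x \<in> reach B src tgt h E x col e})" for col
    proof -
      have "{e \<in> R. h e = x \<or> e \<in> E} \<subseteq> {e \<in> R. x \<in> reach B src tgt h E x col e}"
        by (auto intro: reach.sink) (metis reach.root)
      then show ?thesis using finite_R by (simp add: card_mono)
    qed
    finally show ?thesis using True by auto
  next
    case False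
    then have "U - {x} \<noteq> {}" using x_in by auto
    \<comment> \<open>The sink can be left out of the minimum: it is no tail of an arc, hence no
      in-neighbour of \<open>v\<close>.\<close>
    then obtain v where v: "v \<in> U" "v \<noteq> x" and min: "\<And>u. u \<in> U - {x} \<Longrightarrow> l v \<le> l u"
      using arg_min_if_finite[of "U - {x}" l] finite_U by (metis Diff_iff finite_Diff insertI1 not_le)
    have "card (U - {v}) < card U" using v finite_U by (intro psubset_card_mono) auto
    note IH = less.hyps[OF this]
    have "\<exists>col. \<forall>u\<in>U - {v}. l u \<le> int (card {e \<in> R. u \<in> reach B src tgt h E x col e})"
      using v dem less.prems(1) by (intro colouring_off_vertex[OF IH]) auto
    then obtain col where col: "\<And>u. u \<in> U - {v} \<Longrightarrow> l u \<le> int (card {e \<in> R. u \<in> reach B src tgt h E x col e})"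
      by auto
    have "l v \<le> int (card {e \<in> R. src a \<in> reach B src tgt h E x col e})"
      if "a \<in> B" "src a \<noteq> v" for a
      using col[of "src a"] min[of "src a"] src_in[of a] that by auto
    then obtain col' where sub: "\<And>e. e \<in> R \<Longrightarrow> reach B src tgt h E x col e \<subseteq> reach B src tgt h E x col' e"
      and v': "l v \<le> int (card {e \<in> R. v \<in> reach B src tgt h E x col' e})"
      using saturate[OF v, of "l v" E col] dem[of "{v}" v] v by auto
    have "l u \<le> int (card {e \<in> R. u \<in> reach B src tgt h E x col' e})" if "u \<in> U" for u
    proof (cases "u = v")
      case False
      have "card {e \<in> R. u \<in> reach B src tgt h E x col e} \<le> card {e \<in> R. u \<in> reach B src tgt h E x col' e}"
        using sub finite_R by (intro card_mono) auto
      then show ?thesis using col[of u] that False by auto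
    qed (use v' in auto)
    then show ?thesis by auto
  qed
qed

subsection \<open>Time-respecting paths\<close>

text \<open>Admissible partner sets form a chain, so a greedy choice works: all but a latest
  \<open>q\<close> are matched by induction, and the count at \<open>tau q\<close>, where all of
  \<open>Q\<close> is present, leaves a partner for \<open>q\<close>.\<close>

lemma nested_matching:
  fixes tau :: "'e \<Rightarrow> nat"
  assumes "finite P" "finite Q"
    and "\<And>i. card {q \<in> Q. tau q \<le> i} \<le> card {p \<in> P. tau p \<le> i}"
  shows "\<exists>\<phi>. inj_on \<phi> Q \<and> (\<forall>q\<in>Q. \<phi> q \<in> P \<and> tau (\<phi> q) \<le> tau q)"
  using assms(2,3)
proof (induction "card Q" arbitrary: Q)
  case 0
  then show ?case by auto
next
  case (Suc n)
  from Suc.hyps(2) have "Q \<noteq> {}" by auto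
  have "Max (tau ` Q) \<in> tau ` Q" using Suc.prems(1) \<open>Q \<noteq> {}\<close> by (intro Max_in) auto
  then obtain q where q: "q \<in> Q" "tau q = Max (tau ` Q)" by auto
  then have max: "tau q' \<le> tau q" if "q' \<in> Q" for q' using that Suc.prems(1) by auto
  have "card {q' \<in> Q - {q}. tau q' \<le> i} \<le> card {p \<in> P. tau p \<le> i}" for i
  proof -
    have "card {q' \<in> Q - {q}. tau q' \<le> i} \<le> card {q \<in> Q. tau q \<le> i}"
      using Suc.prems(1) by (intro card_mono) auto
    then show ?thesis using Suc.prems(2)[of i] by simp
  qed
  moreover have "n = card (Q - {q})" using Suc.hyps(2) q by simp
  ultimately have "\<exists>\<phi>. inj_on \<phi> (Q - {q}) \<and> (\<forall>q'\<in>Q - {q}. \<phi> q' \<in> P \<and> tau (\<phi> q') \<le> tau q')"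
    using Suc.prems(1) by (intro Suc.hyps(1)) auto
  then obtain \<phi> where \<phi>: "inj_on \<phi> (Q - {q})"
      "\<And>q'. q' \<in> Q - {q} \<Longrightarrow> \<phi> q' \<in> P \<and> tau (\<phi> q') \<le> tau q'"
    by blast
  have "card (\<phi> ` (Q - {q})) = n" using \<phi>(1) \<open>n = _\<close> by (simp add: card_image)
  also have "n < card {q' \<in> Q. tau q' \<le> tau q}"
  proof -
    have "{q' \<in> Q. tau q' \<le> tau q} = Q" using max by auto
    then show ?thesis using Suc.hyps(2) by simp
  qed
  also have "\<dots> \<le> card {p \<in> P. tau p \<le> tau q}" by (rule Suc.prems)
  finally have "\<not> {p \<in> P. tau p \<le> tau q} \<subseteq> \<phi> ` (Q - {q})"
    using Suc.prems(1) by (meson card_mono finite_Diff finite_imageI not_le)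
  then obtain p where p: "p \<in> P" "tau p \<le> tau q" "p \<notin> \<phi> ` (Q - {q})" by auto
  have "inj_on (\<phi>(q := p)) Q"
    using \<phi>(1) p(3) unfolding inj_on_def fun_upd_apply by (metis Diff_iff image_eqI singletonD)
  then show ?case using \<phi>(2) p by (intro exI[of _ "\<phi>(q := p)"]) auto
qed

lemma preflow_matching:
  assumes "temporal_network V s A src tgt" "pre_flow V A src tgt tau"
  shows "\<exists>\<phi>. inj_on \<phi> {a \<in> A. src a \<in> V} \<and>
    (\<forall>a\<in>A. src a \<in> V \<longrightarrow> \<phi> a \<in> A \<and> tgt (\<phi> a) = src a \<and> tau (\<phi> a) \<le> tau a)"
proof -
  have fin: "finite A" using assms by (auto simp: temporal_network_def)
  have ex: "\<exists>\<phi>. inj_on \<phi> {a \<in> A. src a = v} \<and>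
    (\<forall>q\<in>{a \<in> A. src a = v}. \<phi> q \<in> {a \<in> A. tgt a = v} \<and> tau (\<phi> q) \<le> tau q)" if "v \<in> V" for v
  proof (rule nested_matching)
    fix i
    have "{q \<in> {a \<in> A. src a = v}. tau q \<le> i} = {a \<in> A. src a = v \<and> tau a \<le> i}"
      "{q \<in> {a \<in> A. tgt a = v}. tau q \<le> i} = {a \<in> A. tgt a = v \<and> tau a \<le> i}" by auto
    then show "card {q \<in> {a \<in> A. src a = v}. tau q \<le> i} \<le> card {p \<in> {a \<in> A. tgt a = v}. tau p \<le> i}"
      using assms(2) that by (simp add: pre_flow_def)
  qed (use fin in auto)
  have "\<forall>v\<in>V. \<exists>\<phi>. inj_on \<phi> {a \<in> A. src a = v} \<and>
      (\<forall>q\<in>{a \<in> A. src a = v}. \<phi> q \<in> {a \<in> A. tgt a = v} \<and> tau (\<phi> q) \<le> tau q)"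
    by (intro ballI ex)
  from bchoice[OF this] obtain \<phi> where \<phi>': "\<forall>v\<in>V. inj_on (\<phi> v) {a \<in> A. src a = v} \<and>
      (\<forall>q\<in>{a \<in> A. src a = v}. \<phi> v q \<in> {a \<in> A. tgt a = v} \<and> tau (\<phi> v q) \<le> tau q)" ..
  have \<phi>: "inj_on (\<phi> v) {a \<in> A. src a = v}" if "v \<in> V" for v
    using \<phi>' that by blast
  have \<phi>2: "\<phi> (src q) q \<in> A \<and> tgt (\<phi> (src q) q) = src q \<and> tau (\<phi> (src q) q) \<le> tau q"
    if "q \<in> A" "src q \<in> V" for q
    using \<phi>' that by simp
  have "inj_on (\<lambda>a. \<phi> (src a) a) {a \<in> A. src a \<in> V}"
  proof (rule inj_onI)
    fix a b assume ab: "a \<in> {a \<in> A. src a \<in> V}" "b \<in> {a \<in> A. src a \<in> V}" "\<phi> (src a) a = \<phi> (src b) b"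
    then have "src a = src b" using \<phi>2[of a] \<phi>2[of b] by auto
    then show "a = b" using ab \<phi>[of "src a"] by (auto simp: inj_on_def)
  qed
  then show ?thesis using \<phi>2 by (intro exI[of _ "\<lambda>a. \<phi> (src a) a"]) simp
qed

section \<open>Bounds for the number of disjoint time-respecting paths\<close>

definition disjoint_paths where
  "disjoint_paths A src tgt tau s v ps \<longleftrightarrow>
     (\<forall>p\<in>set ps. is_path A src tgt s v p \<and> tau_respecting tau p) \<and>
     (\<forall>i<length ps. \<forall>j<length ps. i \<noteq> j \<longrightarrow> set (ps ! i) \<inter> set (ps ! j) = {})"

lemma lambda_N_eq_Max:
  "lambda_N A src tgt tau s v = Max {length ps | ps. disjoint_paths A src tgt tau s v ps}"
  unfolding lambda_N_def disjoint_paths_def by (rule arg_cong[where f = Max]) auto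

lemma disjoint_paths_le_hitting_set:
  assumes "finite F" and "\<And>p. is_path A src tgt s v p \<Longrightarrow> tau_respecting tau p \<Longrightarrow> set p \<inter> F \<noteq> {}"
    and ps: "disjoint_paths A src tgt tau s v ps"
  shows "length ps \<le> card F"
proof -
  have "\<exists>a. a \<in> set (ps ! i) \<inter> F" if "i < length ps" for i
    using assms(2)[of "ps ! i"] ps that nth_mem[OF that] unfolding disjoint_paths_def by blast
  then obtain g where g: "\<And>i. i < length ps \<Longrightarrow> g i \<in> set (ps ! i) \<inter> F" by metis
  have "inj_on g {..<length ps}"
  proof (rule inj_onI)
    fix i j assume "i \<in> {..<length ps}" "j \<in> {..<length ps}" "g i = g j"
    then have "set (ps ! i) \<inter> set (ps ! j) \<noteq> {}" "i < length ps" "j < length ps"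
      using g[of i] g[of j] by auto
    then show "i = j" using ps unfolding disjoint_paths_def by blast
  qed
  moreover have "g ` {..<length ps} \<subseteq> F" using g by auto
  ultimately show ?thesis using card_inj_on_le[of g "{..<length ps}" F] assms(1) by auto
qed

text \<open>Weak duality. The same bound shows that the set of path numbers is finite, without which
  \<open>Max\<close> would say nothing.\<close>

lemma lambda_N_le_hitting_set:
  assumes "finite F" and "\<And>p. is_path A src tgt s v p \<Longrightarrow> tau_respecting tau p \<Longrightarrow> set p \<inter> F \<noteq> {}"
  shows "lambda_N A src tgt tau s v \<le> card F"
proof -
  let ?K = "{length ps | ps. disjoint_paths A src tgt tau s v ps}"
  have le: "k \<le> card F" if "k \<in> ?K" for k
  proof -
    from that obtain ps where ps: "k = length ps" "disjoint_paths A src tgt tau s v ps" by blast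
    show ?thesis
      unfolding ps(1) by (rule disjoint_paths_le_hitting_set[OF assms(1) _ ps(2)]) (rule assms(2))
  qed
  then have "finite ?K" by (meson finite_nat_set_iff_bounded_le)
  moreover have "0 \<in> ?K" by (auto simp: disjoint_paths_def)
  ultimately show ?thesis unfolding lambda_N_eq_Max using le by (subst Max_le_iff) auto
qed

lemma lambda_N_ge_disjoint_paths:
  assumes "finite A" "disjoint_paths A src tgt tau s v ps"
  shows "length ps \<le> lambda_N A src tgt tau s v"
proof -
  let ?K = "{length ps | ps. disjoint_paths A src tgt tau s v ps}"
  have hit: "set p \<inter> A \<noteq> {}" if "is_path A src tgt s v p" for p
    using that by (cases p) (auto simp: is_path_def)
  have "k \<le> card A" if "k \<in> ?K" for k
  proof -
    from that obtain ps where ps: "k = length ps" "disjoint_paths A src tgt tau s v ps" by blast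
    show ?thesis
      unfolding ps(1) by (rule disjoint_paths_le_hitting_set[OF assms(1) _ ps(2)]) (rule hit)
  qed
  then have "finite ?K" by (meson finite_nat_set_iff_bounded_le)
  then show ?thesis unfolding lambda_N_eq_Max using assms by (intro Max_ge) auto
qed

text \<open>Consider the last arc with tail outside \<open>X\<close>. If another arc follows, that
  arc lies inside \<open>X\<close> and has time \<open>t\<close>, so the entry happens by time
  \<open>t\<close>; otherwise the entry ends at \<open>v\<close>. Thus a late entry from outside
  \<open>C\<close> can serve \<open>v\<close> alone.\<close>

lemma path_hits_cut:
  assumes p: "is_path A src tgt s v es" "tau_respecting tau es"
    and X: "v \<in> X" "s \<notin> X" "X \<subseteq> C"
    and inner: "\<And>a. a \<in> A \<Longrightarrow> src a \<in> C \<Longrightarrow> tgt a \<in> C \<Longrightarrow> tau a = t"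
  shows "\<exists>a\<in>set es. src a \<notin> X \<and> tgt a \<in> X \<and> (src a \<in> C \<or> tau a \<le> t \<or> tgt a = v)"
proof -
  let ?n = "length es"
  have es: "es \<noteq> []" "set es \<subseteq> A" "src (es ! 0) = s" "tgt (es ! (?n - 1)) = v"
    and seq: "\<And>i. Suc i < ?n \<Longrightarrow> tgt (es ! i) = src (es ! Suc i)"
    using p(1) by (auto simp: is_path_def hd_conv_nth last_conv_nth)
  define I where "I = {i. i < ?n \<and> src (es ! i) \<notin> X}"
  have "0 \<in> I" using es X by (auto simp: I_def)
  have "finite I" by (auto simp: I_def)
  define i where "i = Max I"
  have "i \<in> I" unfolding i_def using \<open>finite I\<close> \<open>0 \<in> I\<close> by (intro Max_in) auto
  then have i: "i < ?n" "src (es ! i) \<notin> X" by (auto simp: I_def)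
  have later: "src (es ! k) \<in> X" if "i < k" "k < ?n" for k
  proof (rule ccontr)
    assume "src (es ! k) \<notin> X"
    then have "k \<in> I" using that by (simp add: I_def)
    then show False using Max_ge[OF \<open>finite I\<close>, of k] that by (simp add: i_def)
  qed
  have tgt_X: "tgt (es ! k) \<in> X" if "i \<le> k" "k < ?n" for k
  proof (cases "Suc k < ?n")
    case True
    then show ?thesis using seq later[of "Suc k"] that by auto
  next
    case False
    then have "k = ?n - 1" using that by auto
    then show ?thesis using es X by auto
  qed
  show ?thesis
  proof (cases "Suc i < ?n")
    case True
    then have "tau (es ! Suc i) = t"
      using later[of "Suc i"] tgt_X[of "Suc i"] es X by (intro inner) auto
    moreover have "tau (es ! i) \<le> tau (es ! Suc i)"
      using p(2) True unfolding tau_respecting_def sorted_iff_nth_Suc by auto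
    ultimately show ?thesis using i tgt_X[of i] by (intro bexI[of _ "es ! i"]) auto
  next
    case False
    then have "i = ?n - 1" using i by auto
    then show ?thesis using i es tgt_X[of i] by (intro bexI[of _ "es ! i"]) auto
  qed
qed

lemma is_path_snoc:
  assumes "is_path F src tgt x u es" "a \<in> F" "src a = u" "tgt a = v" "v \<notin> set (map src es)" "v \<noteq> u"
  shows "is_path F src tgt x v (es @ [a])"
  unfolding is_path_def
proof (intro conjI allI impI)
  show "es @ [a] \<noteq> []" "set (es @ [a]) \<subseteq> F" "src (hd (es @ [a])) = x" "tgt (last (es @ [a])) = v"
    using assms by (auto simp: is_path_def)
  show "distinct (map src (es @ [a]) @ [v])" using assms by (auto simp: is_path_def)
  fix i assume i: "Suc i < length (es @ [a])"
  show "tgt ((es @ [a]) ! i) = src ((es @ [a]) ! Suc i)"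
  proof (cases "Suc i < length es")
    case True
    then show ?thesis using assms(1) by (simp add: is_path_def nth_append)
  next
    case False
    then have "i = length es - 1" "Suc i = length es" using i by auto
    then show ?thesis using assms(1,3) by (auto simp: is_path_def nth_append last_conv_nth)
  qed
qed

text \<open>Arcs are collected instead of vertices, because the time of the last arc decides what
  may follow.\<close>

inductive_set treach ::
  "'e set \<Rightarrow> ('e \<Rightarrow> 'v) \<Rightarrow> ('e \<Rightarrow> 'v) \<Rightarrow> ('e \<Rightarrow> nat) \<Rightarrow> 'v \<Rightarrow> ('e \<Rightarrow> 'e) \<Rightarrow> 'e set"
  for A src tgt tau s col where
  start: "a \<in> A \<Longrightarrow> src a = s \<Longrightarrow> a \<in> treach A src tgt tau s col"
| step: "a' \<in> treach A src tgt tau s col \<Longrightarrow> a \<in> A \<Longrightarrow> tgt a' = src a \<Longrightarrow> tau a' \<le> tau a \<Longrightarrow>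
    col a = col a' \<Longrightarrow> a \<in> treach A src tgt tau s col"

lemma treach_subset: "a \<in> treach A src tgt tau s col \<Longrightarrow> a \<in> A"
  by (induction rule: treach.induct)

text \<open>Traced backwards, a walk to such an arc has all its tails in \<open>insert s U\<close>,
  so colours elsewhere cannot affect it.\<close>

lemma treach_extend:
  assumes net: "temporal_network V s A src tgt"
    and closed: "\<And>a. a \<in> A \<Longrightarrow> tgt a \<in> U \<Longrightarrow> src a \<in> insert s U"
    and agree: "\<And>a. a \<in> A \<Longrightarrow> src a \<in> insert s U \<Longrightarrow> col' a = col a"
    and a: "a \<in> treach A src tgt tau s col" "src a \<in> insert s U"
  shows "a \<in> treach A src tgt tau s col'"
  using a
proof induction
  case (start a)
  then show ?case by (auto intro: treach.start)
next
  case (step a' a)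
  have "a' \<in> A" using treach_subset[OF step.hyps(1)] .
  then have "tgt a' \<noteq> s" using net by (auto simp: temporal_network_def)
  then have "tgt a' \<in> U" using step.hyps(3) step.prems by simp
  then have src: "src a' \<in> insert s U" by (rule closed[OF \<open>a' \<in> A\<close>])
  have "col' a = col' a'"
    using agree[OF step.hyps(2) step.prems] agree[OF \<open>a' \<in> A\<close> src] step.hyps(5) by simp
  from treach.step[OF step.IH[OF src] step.hyps(2-4) this] show ?case .
qed

subsection \<open>Extending a colouring to one more strongly connected component\<close>

locale matched_network =
  fixes V :: "'v set" and s :: 'v and A :: "'e set" and src tgt :: "'e \<Rightarrow> 'v"
    and tau :: "'e \<Rightarrow> nat" and \<phi> :: "'e \<Rightarrow> 'e"
  assumes net: "temporal_network V s A src tgt"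
    and inj_\<phi>: "inj_on \<phi> {a \<in> A. src a \<in> V}"
    and \<phi>: "a \<in> A \<Longrightarrow> src a \<in> V \<Longrightarrow> \<phi> a \<in> A \<and> tgt (\<phi> a) = src a \<and> tau (\<phi> a) \<le> tau a"
begin

lemma finite_V: "finite V" and finite_A: "finite A" and s_notin: "s \<notin> V"
  using net by (auto simp: temporal_network_def)

lemma arc_ends: "a \<in> A \<Longrightarrow> src a \<in> insert s V" "a \<in> A \<Longrightarrow> tgt a \<in> V"
  using net by (auto simp: temporal_network_def)

definition closed_above :: "'v set \<Rightarrow> bool" where
  "closed_above U \<longleftrightarrow> U \<subseteq> V \<and> (\<forall>a\<in>A. tgt a \<in> U \<longrightarrow> src a \<in> insert s U)"

definition leaving :: "'v set \<Rightarrow> 'e set" where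
  "leaving U = {a \<in> A. src a \<in> insert s U \<and> tgt a \<notin> U}"

definition colours_at :: "('e \<Rightarrow> 'e) \<Rightarrow> 'v \<Rightarrow> 'e set" where
  "colours_at col v = col ` {a \<in> treach A src tgt tau s col. tgt a = v}"

lemma colours_atI: "a \<in> treach A src tgt tau s col \<Longrightarrow> col a = j \<Longrightarrow> tgt a = v \<Longrightarrow> j \<in> colours_at col v"
  by (auto simp: colours_at_def)

lemma finite_colours_at: "finite (colours_at col v)"
  unfolding colours_at_def using finite_subset[OF _ finite_A] treach_subset
  by (metis (no_types, lifting) finite_imageI mem_Collect_eq subsetI)

text \<open>Only a lower bound on the number of colours is maintained; the reverse one comes from
  disjoint paths in the extracted trees.\<close>

definition good_colouring :: "'v set \<Rightarrow> ('e \<Rightarrow> 'e) \<Rightarrow> bool" where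
  "good_colouring U col \<longleftrightarrow>
     (\<forall>a\<in>A. src a = s \<longrightarrow> col a = a) \<and>
     inj_on col (leaving U) \<and> leaving U \<subseteq> treach A src tgt tau s col \<and>
     (\<forall>v\<in>U. lambda_N A src tgt tau s v \<le> card (colours_at col v))"

end

locale component = matched_network +
  fixes U :: "'a set" and C :: "'a set" and t :: nat and col :: "'b \<Rightarrow> 'b"
  assumes closed_U: "closed_above U" and closed_UC: "closed_above (U \<union> C)" and disj: "U \<inter> C = {}"
    and inner_time: "a \<in> A \<Longrightarrow> src a \<in> C \<Longrightarrow> tgt a \<in> C \<Longrightarrow> tau a = t"
    and good: "good_colouring U col"
begin

text \<open>
  The arcs entering \<open>C\<close> by time \<open>t\<close> are the roots of the local problem, and \<open>s\<close> is recycled as its sink,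
  entered by the exits that may be served by any tree. An exit before time \<open>t\<close> has to be served by the
  tree of its \<open>\<phi>\<close>-partner, which is why that partner (in \<open>used\<close>) gets its own arc to the sink.
\<close>

definition "early = {a \<in> A. src a \<in> insert s U \<and> tgt a \<in> C \<and> tau a \<le> t}"
definition "late = {a \<in> A. src a \<in> insert s U \<and> tgt a \<in> C \<and> t < tau a}"
definition "inner = {a \<in> A. src a \<in> C \<and> tgt a \<in> C}"
definition "exits = {a \<in> A. src a \<in> C \<and> tgt a \<notin> C}"
definition "early_exits = {f \<in> exits. tau f < t}"
definition "free_exits = {f \<in> exits. t \<le> tau f \<and> \<phi> f \<notin> late}"
definition "used = \<phi> ` early_exits"
definition "head b = (if b \<in> inner then tgt b else s)"

section \<open>The matching restricted to one component\<close>

lemma C_sub: "C \<subseteq> V" using closed_UC by (auto simp: closed_above_def)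

lemma s_notin_C: "s \<notin> C" and s_notin_U: "s \<notin> U"
  using closed_UC s_notin by (auto simp: closed_above_def)

lemma fin: "finite early" "finite late" "finite inner" "finite exits" "finite early_exits"
  "finite free_exits" "finite used" "finite C"
  using finite_A finite_subset[OF C_sub finite_V]
  by (simp_all add: early_def late_def inner_def exits_def early_exits_def free_exits_def used_def)

lemma into_C: "a \<in> A \<Longrightarrow> tgt a \<in> C \<Longrightarrow> a \<in> early \<or> a \<in> late \<or> a \<in> inner"
  using closed_UC by (auto simp: closed_above_def early_def late_def inner_def)

lemma \<phi>_cases: 
  assumes "f \<in> inner \<union> exits"
  shows "\<phi> f \<in> A" "tgt (\<phi> f) = src f" "tau (\<phi> f) \<le> tau f" "\<phi> f \<in> early \<or> \<phi> f \<in> late \<or> \<phi> f \<in> inner"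
proof -
  have "f \<in> A" "src f \<in> C" using assms by (auto simp: inner_def exits_def)
  then show "\<phi> f \<in> A" "tgt (\<phi> f) = src f" "tau (\<phi> f) \<le> tau f" using \<phi>[of f] C_sub by auto
  then show "\<phi> f \<in> early \<or> \<phi> f \<in> late \<or> \<phi> f \<in> inner"
    using into_C[of "\<phi> f"] \<open>src f \<in> C\<close> by simp
qed

lemma \<phi>_inj: "inj_on \<phi> (inner \<union> exits)"
  using C_sub by (intro inj_on_subset[OF inj_\<phi>]) (auto simp: inner_def exits_def)

text \<open>The partner of an exit before time \<open>t\<close> is itself before \<open>t\<close>,
  hence neither inner nor late.\<close>

lemma used_early: "used \<subseteq> early"
proof
  fix e assume "e \<in> used"
  then obtain f where f: "f \<in> exits" "tau f < t" "e = \<phi> f" by (auto simp: used_def early_exits_def)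
  then have "tau e < t" using \<phi>_cases(3)[of f] by auto
  moreover from this have "e \<notin> inner" "e \<notin> late" using inner_time[of e] by (auto simp: inner_def late_def)
  ultimately show "e \<in> early" using \<phi>_cases(4)[of f] f by auto
qed

text \<open>Inner arcs have time \<open>t\<close>, so their partners are not late; for free exits
  this is part of the definition. Injectivity of \<open>\<phi>\<close> keeps them apart from the
  partners of early exits.\<close>

lemma \<phi>_inner_free:
  assumes "f \<in> inner \<union> free_exits"
  shows "\<phi> f \<in> inner \<or> \<phi> f \<in> early - used"
proof -
  have f: "f \<in> inner \<union> exits" using assms by (auto simp: free_exits_def)
  have "\<phi> f \<notin> late"
  proof (cases "f \<in> inner")
    case True
    then have "tau (\<phi> f) \<le> t" using \<phi>_cases(3)[OF f] inner_time[of f] by (auto simp: inner_def)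
    then show ?thesis by (simp add: late_def)
  next
    case False
    then show ?thesis using assms by (simp add: free_exits_def)
  qed
  moreover have "\<phi> f \<notin> used"
  proof
    assume "\<phi> f \<in> used"
    then obtain g where g: "g \<in> early_exits" "\<phi> f = \<phi> g" by (auto simp: used_def)
    then have "f = g" using f inj_onD[OF \<phi>_inj, of f g] by (simp add: early_exits_def)
    then show False using g assms by (auto simp: early_exits_def free_exits_def inner_def exits_def)
  qed
  ultimately show ?thesis using \<phi>_cases(4)[OF f] by blast
qed

text \<open>The roots in \<open>used\<close> are held in reserve for early exits; leaving them out
  of this count is what makes the demand of the sink feasible.\<close>

lemma card_out_le:
  "card {b \<in> inner \<union> free_exits. src b \<in> X} \<le>
    card {b \<in> inner. tgt b \<in> X} + card {e \<in> early - used. tgt e \<in> X}"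
proof -
  have "card {b \<in> inner \<union> free_exits. src b \<in> X} = card (\<phi> ` {b \<in> inner \<union> free_exits. src b \<in> X})"
    by (intro card_image[symmetric] inj_on_subset[OF \<phi>_inj]) (auto simp: free_exits_def)
  also have "\<dots> \<le> card ({b \<in> inner. tgt b \<in> X} \<union> {e \<in> early - used. tgt e \<in> X})"
  proof (rule card_mono)
    show "\<phi> ` {b \<in> inner \<union> free_exits. src b \<in> X} \<subseteq> {b \<in> inner. tgt b \<in> X} \<union> {e \<in> early - used. tgt e \<in> X}"
    proof
      fix a assume "a \<in> \<phi> ` {b \<in> inner \<union> free_exits. src b \<in> X}"
      then obtain b where b: "b \<in> inner \<union> free_exits" "src b \<in> X" "a = \<phi> b" by auto
      then have "tgt a \<in> X" using \<phi>_cases(2)[of b] by (auto simp: free_exits_def)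
      then show "a \<in> {b \<in> inner. tgt b \<in> X} \<union> {e \<in> early - used. tgt e \<in> X}"
        using \<phi>_inner_free[OF b(1)] b(3) by auto
    qed
  qed (use fin in auto)
  also have "\<dots> \<le> card {b \<in> inner. tgt b \<in> X} + card {e \<in> early - used. tgt e \<in> X}"
    by (rule card_Un_le)
  finally show ?thesis .
qed

abbreviation "B \<equiv> inner \<union> free_exits"

lemma free_not_inner: "f \<in> free_exits \<Longrightarrow> f \<notin> inner"
  by (auto simp: free_exits_def exits_def inner_def)

lemma src_B: "b \<in> B \<Longrightarrow> src b \<in> C"
  by (auto simp: inner_def free_exits_def exits_def)

lemma finite_BB: "finite B" using fin by simp

section \<open>The local problem and its cut demands\<close>

lemma rooted: "rooted_preflow (insert s C) s B src head early tgt"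
proof
  fix u assume "u \<in> insert s C"
  show "(\<Sum>b\<in>B. of_bool (src b = u) :: int) \<le> (\<Sum>b\<in>B. of_bool (head b = u)) + (\<Sum>e\<in>early. of_bool (tgt e = u))"
  proof (cases "u = s")
    case True
    have "{b \<in> B. src b = s} = {}" using src_B s_notin_C by auto
    then have "card {b \<in> B. src b = s} = 0" by (metis card.empty)
    then show ?thesis unfolding sum_of_bool_card[OF finite_BB] sum_of_bool_card[OF fin(1)] True by linarith
  next
    case False
    have "card {b \<in> B. src b \<in> {u}} \<le> card {b \<in> inner. tgt b \<in> {u}} + card {e \<in> early - used. tgt e \<in> {u}}"
      by (rule card_out_le)
    moreover have "card {b \<in> inner. tgt b \<in> {u}} \<le> card {b \<in> B. head b = u}"
      using finite_BB by (intro card_mono) (auto simp: head_def)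
    moreover have "card {e \<in> early - used. tgt e \<in> {u}} \<le> card {e \<in> early. tgt e = u}"
      using fin by (intro card_mono) auto
    ultimately show ?thesis unfolding sum_of_bool_card[OF finite_BB] sum_of_bool_card[OF fin(1)] by simp
  qed
next
  fix b assume b: "b \<in> B"
  show "src b \<in> insert s C - {s}" using src_B[OF b] s_notin_C by auto
  show "head b \<in> insert s C" using b by (auto simp: head_def inner_def)
qed (use fin in auto)

abbreviation "icut X \<equiv> incut B src head early tgt used s X"

text \<open>No arc of \<open>B\<close> starts at the sink, so removing it makes no arc enter. Hence
  cuts inside \<open>C\<close> determine the demands in \<open>C\<close>.\<close>

lemma icut_remove_sink: "icut (X - {s}) \<le> icut X"
proof -
  have "(\<Sum>b\<in>B. of_bool (src b \<notin> X - {s} \<and> head b \<in> X - {s}) :: int) \<le> (\<Sum>b\<in>B. of_bool (src b \<notin> X \<and> head b \<in> X))"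
  proof (rule sum_mono)
    fix b assume "b \<in> B"
    then have "src b \<noteq> s" using src_B s_notin_C by auto
    then show "of_bool (src b \<notin> X - {s} \<and> head b \<in> X - {s}) \<le> (of_bool (src b \<notin> X \<and> head b \<in> X) :: int)"
      by simp
  qed
  moreover have "(\<Sum>e\<in>early. of_bool (tgt e \<in> X - {s} \<or> e \<in> used \<and> s \<in> X - {s}) :: int)
      \<le> (\<Sum>e\<in>early. of_bool (tgt e \<in> X \<or> e \<in> used \<and> s \<in> X))"
    by (rule sum_mono) auto
  ultimately show ?thesis unfolding incut_def by linarith
qed

text \<open>Used roots count through their second arc. Free exits with tail in \<open>X\<close> are
  balanced, by \<open>card_out_le\<close>, against inner arcs and other roots entering
  \<open>X\<close>.\<close>

lemma icut_sink:
  assumes "s \<in> X" "X \<subseteq> insert s C"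
  shows "int (card used + card free_exits) \<le> icut X"
proof -
  have 1: "(\<Sum>b\<in>B. of_bool (b \<in> free_exits) + of_bool (b \<in> inner \<and> tgt b \<in> X) :: int)
    \<le> (\<Sum>b\<in>B. of_bool (src b \<notin> X \<and> head b \<in> X) + of_bool (src b \<in> X))"
  proof (rule sum_mono)
    fix b assume "b \<in> B"
    then show "of_bool (b \<in> free_exits) + of_bool (b \<in> inner \<and> tgt b \<in> X)
      \<le> (of_bool (src b \<notin> X \<and> head b \<in> X) + of_bool (src b \<in> X) :: int)"
      using assms(1) free_not_inner[of b] by (cases "b \<in> inner") (auto simp: head_def)
  qed
  have 2: "(\<Sum>e\<in>early. of_bool (e \<in> used) + of_bool (e \<notin> used \<and> tgt e \<in> X) :: int)
    \<le> (\<Sum>e\<in>early. of_bool (tgt e \<in> X \<or> e \<in> used \<and> s \<in> X))"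
    using assms(1) by (intro sum_mono) (auto simp: of_bool_def)
  have eqs: "{b \<in> B. b \<in> free_exits} = free_exits" "{b \<in> B. b \<in> inner \<and> tgt b \<in> X} = {b \<in> inner. tgt b \<in> X}"
    "{e \<in> early. e \<in> used} = used" "{e \<in> early. e \<notin> used \<and> tgt e \<in> X} = {e \<in> early - used. tgt e \<in> X}"
    using used_early by auto
  show ?thesis
    using 1 2 card_out_le[of X] unfolding incut_def sum.distrib
    unfolding sum_of_bool_card[OF finite_BB] sum_of_bool_card[OF fin(1)] eqs by linarith
qed

text \<open>The sink demands as many colours as it has entrances. A vertex of \<open>C\<close>
  demands the most that the cuts inside \<open>C\<close> permit.\<close>

definition demand :: "'a \<Rightarrow> int" where
  "demand u = (if u = s then int (card used + card free_exits) else Min (icut ` {X. X \<subseteq> C \<and> u \<in> X}))"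

lemma finite_cuts: "finite (icut ` {X. X \<subseteq> C \<and> u \<in> X})"
  using fin(8) by auto

lemma demand_le_icut:
  assumes "X \<subseteq> insert s C" "u \<in> X"
  shows "demand u \<le> icut X"
proof (cases "u = s")
  case True
  then show ?thesis using icut_sink[of X] assms by (simp add: demand_def)
next
  case False
  then have "X - {s} \<in> {X. X \<subseteq> C \<and> u \<in> X}" using assms by auto
  then have "icut (X - {s}) \<in> icut ` {X. X \<subseteq> C \<and> u \<in> X}" by (rule imageI)
  then have "demand u \<le> icut (X - {s})" using finite_cuts False by (simp add: demand_def)
  then show ?thesis using icut_remove_sink[of X] by linarith
qed

definition loc_col :: "'b \<Rightarrow> 'b" where
  "loc_col = (SOME c. \<forall>u\<in>insert s C. demand u \<le> int (card {e \<in> early. u \<in> reach B src head tgt used s c e}))"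

abbreviation "W e \<equiv> reach B src head tgt used s loc_col e"

lemma loc_col:
  assumes "u \<in> insert s C"
  shows "demand u \<le> int (card {e \<in> early. u \<in> W e})"
proof -
  have "\<exists>c. \<forall>u\<in>insert s C. demand u \<le> int (card {e \<in> early. u \<in> reach B src head tgt used s c e})"
    using demand_le_icut by (rule colouring_exists[OF rooted])
  from someI_ex[OF this, folded loc_col_def] show ?thesis
    using assms by (rule bspec)
qed

text \<open>Pigeonhole with equality: a colour at the sink came by its own second arc or by a free
  exit, and as many colours are demanded as there are such entrances. So no two share a colour, and
  each free exit is reached in its own colour.\<close>

lemma free_exits_coloured:
  "inj_on loc_col free_exits" "loc_col ` free_exits \<subseteq> early - used"
  "m \<in> free_exits \<Longrightarrow> src m \<in> W (loc_col m)"
proof -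
  define Z where "Z = {e \<in> early. s \<in> W e}"
  have via: "e \<in> used \<or> (\<exists>m\<in>free_exits. loc_col m = e \<and> src m \<in> W e)" if "e \<in> Z" for e
  proof -
    have e: "e \<in> early" "s \<in> W e" using that by (auto simp: Z_def)
    from e(2) show ?thesis
    proof cases
      case root
      moreover have "tgt e \<in> C" using e(1) unfolding early_def by blast
      ultimately show ?thesis using s_notin_C by metis
    next
      case sink
      then show ?thesis by simp
    next
      case (step b)
      have "b \<notin> inner"
      proof
        assume "b \<in> inner"
        then have "head b \<in> C" by (simp add: head_def inner_def)
        then show False using step s_notin_C by metis
      qed
      then show ?thesis using step by blast
    qed
  qed
  have le: "card used + card free_exits \<le> card Z"
    using loc_col[of s] by (simp add: demand_def Z_def)
  have sub: "Z \<subseteq> used \<union> loc_col ` free_exits" using via by auto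
  have fU: "finite (used \<union> loc_col ` free_exits)" using fin by auto
  have c1: "card (loc_col ` free_exits) \<le> card free_exits" using fin by (intro card_image_le)
  have c2: "card (used \<union> loc_col ` free_exits) \<le> card used + card (loc_col ` free_exits)"
    by (rule card_Un_le)
  have Z: "Z = used \<union> loc_col ` free_exits"
    using c1 c2 le by (intro card_seteq[OF fU sub]) linarith
  then have c3: "card (used \<union> loc_col ` free_exits) = card used + card (loc_col ` free_exits)"
    "card (loc_col ` free_exits) = card free_exits"
    using c1 c2 le by auto
  show inj: "inj_on loc_col free_exits" using c3(2) fin by (intro eq_card_imp_inj_on) auto
  have disj': "used \<inter> loc_col ` free_exits = {}"
    using c3(1) card_Un_Int[of used "loc_col ` free_exits"] fin by auto
  show "loc_col ` free_exits \<subseteq> early - used" using disj' Z by (auto simp: Z_def)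
  assume m: "m \<in> free_exits"
  then have "loc_col m \<in> Z" "loc_col m \<notin> used" using Z disj' by auto
  then obtain m' where "m' \<in> free_exits" "loc_col m' = loc_col m" "src m' \<in> W (loc_col m)"
    using via by blast
  then show "src m \<in> W (loc_col m)" using inj m by (auto dest: inj_onD)
qed

section \<open>Gluing the local colouring to the given one\<close>

definition origin :: "'b \<Rightarrow> 'b" where
  "origin a = (if a \<in> B then loc_col a else if src a \<in> C then \<phi> a else a)"

text \<open>For an exit, \<open>origin a\<close> is the entry of \<open>C\<close> whose tree carries
  it. As \<open>col\<close> is injective on entries, exits have distinct colours once their origins
  are distinct.\<close>

definition "col' a = col (origin a)"

lemma col'_old: "src a \<in> insert s U \<Longrightarrow> col' a = col a"
  using src_B[of a] disj s_notin_C by (auto simp: col'_def origin_def)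

lemma treach_old: "a \<in> treach A src tgt tau s col \<Longrightarrow> src a \<in> insert s U \<Longrightarrow> a \<in> treach A src tgt tau s col'"
  using closed_U by (intro treach_extend[OF net, of U col' col]) (simp_all add: closed_above_def col'_old)

lemma entry_leaving: "a \<in> early \<union> late \<Longrightarrow> a \<in> leaving U"
  using disj by (auto simp: early_def late_def leaving_def)

lemma entry_treach: "a \<in> early \<union> late \<Longrightarrow> a \<in> treach A src tgt tau s col' \<and> col' a = col a"
  using good entry_leaving[of a] treach_old[of a] col'_old[of a]
  by (auto simp: good_colouring_def early_def late_def)

text \<open>Entries arrive by time \<open>t\<close> and inner arcs have time \<open>t\<close>, so
  static reachability is already time-respecting. The bound \<open>tau a \<le> t\<close> lets a free
  exit follow.\<close>

lemma W_treach:
  assumes "e \<in> early" "w \<in> W e" "w \<noteq> s"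
  shows "\<exists>a\<in>treach A src tgt tau s col'. tgt a = w \<and> col' a = col e \<and> tau a \<le> t"
  using assms(2,3)
proof induction
  case root
  then show ?case using entry_treach[of e] assms(1) by (intro bexI[of _ e]) (auto simp: early_def)
next
  case sink
  then show ?case by simp
next
  case (step b)
  have "src b \<noteq> s" using src_B[OF step.hyps(1)] s_notin_C by auto
  from step.IH[OF this] obtain a where a: "a \<in> treach A src tgt tau s col'" "tgt a = src b"
    "col' a = col e" "tau a \<le> t" by blast
  have b: "b \<in> inner" "head b = tgt b" using step.prems by (auto simp: head_def split: if_splits)
  have tb: "tau b = t" and bA: "b \<in> A" using b inner_time by (auto simp: inner_def)
  have cb: "col' b = col e" using step.hyps by (simp add: col'_def origin_def)
  have "b \<in> treach A src tgt tau s col'"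
    using a tb bA cb by (intro treach.step[OF a(1)]) auto
  then show ?case using b cb tb by (intro bexI[of _ b]) auto
qed

lemma exit_cases: "f \<in> exits \<Longrightarrow> f \<in> free_exits \<or> f \<in> early_exits \<or> (f \<notin> B \<and> \<phi> f \<in> late)"
  by (auto simp: free_exits_def early_exits_def exits_def inner_def)

lemma origin_exit:
  assumes "f \<in> exits"
  shows "f \<in> free_exits \<and> origin f = loc_col f \<and> origin f \<in> early - used \<or>
    f \<notin> free_exits \<and> origin f = \<phi> f \<and> origin f \<in> used \<union> late"
proof (cases "f \<in> free_exits")
  case True
  then show ?thesis using free_exits_coloured(2) by (auto simp: origin_def)
next
  case False
  moreover have "f \<notin> inner" "src f \<in> C" using assms by (auto simp: exits_def inner_def)
  ultimately have "origin f = \<phi> f" by (auto simp: origin_def)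
  then show ?thesis using exit_cases[OF assms] False by (auto simp: used_def)
qed

text \<open>A free exit, leaving at \<open>t\<close> or later, follows any arrival by
  \<open>t\<close>; every other exit follows its partner directly.\<close>

lemma exit_treach:
  assumes "f \<in> exits"
  shows "f \<in> treach A src tgt tau s col'"
proof -
  have fA: "f \<in> A" "src f \<in> C" using assms by (auto simp: exits_def)
  consider "f \<in> free_exits" "origin f = loc_col f" "origin f \<in> early - used"
    | "origin f = \<phi> f" "origin f \<in> used \<union> late" using origin_exit[OF assms] by blast
  then show ?thesis
  proof cases
    case 1
    have "src f \<noteq> s" using fA s_notin_C by auto
    then obtain a where a: "a \<in> treach A src tgt tau s col'" "tgt a = src f" "col' a = col (loc_col f)" "tau a \<le> t"
      using W_treach[of "loc_col f" "src f"] free_exits_coloured(3)[OF 1(1)] 1 by auto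
    then show ?thesis
      using 1 fA by (intro treach.step[OF a(1)]) (auto simp: free_exits_def col'_def)
  next
    case 2
    then have "\<phi> f \<in> early \<union> late" using used_early by (metis Un_iff subsetD)
    from entry_treach[OF this] have *: "\<phi> f \<in> treach A src tgt tau s col'" "col' (\<phi> f) = col (\<phi> f)" by auto
    then show ?thesis
      using \<phi>_cases(2,3)[of f] assms fA 2 by (intro treach.step[OF *(1)]) (auto simp: col'_def)
  qed
qed

lemma leaving_UC: "leaving (U \<union> C) = (leaving U - (early \<union> late)) \<union> exits"
proof -
  have "tgt a \<notin> U" if "a \<in> A" "src a \<in> C" for a
  proof
    assume "tgt a \<in> U"
    then have "src a \<in> insert s U" using closed_U that(1) unfolding closed_above_def by blast
    then show False using that(2) disj s_notin_C by blast
  qed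
  moreover have "early \<union> late = {a \<in> A. src a \<in> insert s U \<and> tgt a \<in> C}"
    unfolding early_def late_def by auto
  ultimately show ?thesis unfolding leaving_def exits_def by blast
qed

text \<open>Three disjoint ranges: arcs bypassing \<open>C\<close> stay fixed, free exits go to
  \<open>early - used\<close>, and the remaining exits go by \<open>\<phi>\<close> to
  \<open>used \<union> late\<close>.\<close>

lemma origin_inj: "inj_on origin (leaving (U \<union> C))" "origin ` leaving (U \<union> C) \<subseteq> leaving U"
proof -
  have old: "origin a = a" if "a \<in> leaving U" for a
  proof -
    have "src a \<notin> C" using that disj s_notin_C unfolding leaving_def by blast
    moreover from this have "a \<notin> B" using src_B by blast
    ultimately show ?thesis by (simp add: origin_def)
  qed
  have ex: "origin f \<in> early \<union> late" if "f \<in> exits" for f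
    using origin_exit[OF that] used_early by (elim disjE conjE) auto
  show "origin ` leaving (U \<union> C) \<subseteq> leaving U"
  proof
    fix o' assume "o' \<in> origin ` leaving (U \<union> C)"
    then obtain a where "a \<in> leaving (U \<union> C)" "o' = origin a" by auto
    then consider "a \<in> leaving U" "o' = origin a" | "a \<in> exits" "o' = origin a" unfolding leaving_UC by blast
    then show "o' \<in> leaving U"
    proof cases
      case 1
      then show ?thesis using old[of a] by simp
    next
      case 2
      then show ?thesis using entry_leaving[OF ex[of a]] by simp
    qed
  qed
  have exits_inj: "inj_on origin exits"
  proof (rule inj_onI)
    fix f g assume fg: "f \<in> exits" "g \<in> exits" "origin f = origin g"
    have dj: "(early - used) \<inter> (used \<union> late) = {}" by (auto simp: early_def late_def)
    show "f = g"
    proof (cases "f \<in> free_exits")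
      case True
      have f: "origin f = loc_col f \<and> origin f \<in> early - used"
        using origin_exit[OF fg(1)] True by metis
      then have "origin g \<notin> used \<union> late" using fg(3) dj by (metis disjoint_iff)
      then have g: "g \<in> free_exits \<and> origin g = loc_col g" using origin_exit[OF fg(2)] by metis
      have "loc_col f = loc_col g" using f g fg(3) by metis
      then show ?thesis using True g inj_onD[OF free_exits_coloured(1)] by metis
    next
      case False
      have f: "origin f = \<phi> f \<and> origin f \<in> used \<union> late"
        using origin_exit[OF fg(1)] False by metis
      then have "origin g \<notin> early - used" using fg(3) dj by (metis disjoint_iff)
      then have g: "origin g = \<phi> g" using origin_exit[OF fg(2)] by metis
      have "\<phi> f = \<phi> g" using f g fg(3) by metis
      then show ?thesis using fg(1,2) inj_onD[OF \<phi>_inj] by (metis UnI2)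
    qed
  qed
  show "inj_on origin (leaving (U \<union> C))"
    unfolding leaving_UC
  proof (subst inj_on_Un, intro conjI exits_inj)
    show "inj_on origin (leaving U - (early \<union> late))" using old by (intro inj_onI) auto
    show "origin ` (leaving U - (early \<union> late) - exits) \<inter> origin ` (exits - (leaving U - (early \<union> late))) = {}"
    proof -
      have "origin ` (leaving U - (early \<union> late)) \<inter> (early \<union> late) = {}" using old by auto
      moreover have "origin ` exits \<subseteq> early \<union> late" using ex by blast
      ultimately show ?thesis by blast
    qed
  qed
qed

text \<open>For \<open>X\<close> attaining the demand of \<open>v\<close>, the inner and early arcs
  entering \<open>X\<close> and the late arcs entering \<open>v\<close> meet every path. The local
  colouring matches the number of the former; each of the latter adds a colour, by injectivity of
  \<open>col\<close>.\<close>

lemma lambda_le_C: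
  assumes "v \<in> C"
  shows "lambda_N A src tgt tau s v \<le> card (colours_at col' v)"
proof -
  have vs: "v \<noteq> s" using assms s_notin_C by auto
  have "icut ` {X. X \<subseteq> C \<and> v \<in> X} \<noteq> {}" using assms by auto
  then have "demand v \<in> icut ` {X. X \<subseteq> C \<and> v \<in> X}"
    using Min_in[OF finite_cuts] vs by (simp add: demand_def)
  then obtain X where X: "X \<subseteq> C" "v \<in> X" "demand v = icut X" by auto
  have sX: "s \<notin> X" using X s_notin_C by auto
  define F where "F = {b \<in> inner. src b \<notin> X \<and> tgt b \<in> X} \<union> {e \<in> early. tgt e \<in> X} \<union> {a \<in> late. tgt a = v}"
  have finF: "finite F" using fin by (simp add: F_def)
  have "lambda_N A src tgt tau s v \<le> card F"
  proof (rule lambda_N_le_hitting_set[OF finF])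
    fix p assume p: "is_path A src tgt s v p" "tau_respecting tau p"
    obtain a where a: "a \<in> set p" "src a \<notin> X" "tgt a \<in> X" "src a \<in> C \<or> tau a \<le> t \<or> tgt a = v"
      using path_hits_cut[OF p X(2) sX X(1) inner_time] by blast
    have aA: "a \<in> A" using a p by (auto simp: is_path_def)
    have aC: "tgt a \<in> C" using a X by auto
    have "a \<in> F"
      using into_C[OF aA aC]
    proof (elim disjE)
      assume "a \<in> late"
      then have "tgt a = v" using a disj s_notin_C by (auto simp: late_def)
      then show "a \<in> F" using \<open>a \<in> late\<close> by (simp add: F_def)
    qed (use a in \<open>auto simp: F_def\<close>)
    then show "set p \<inter> F \<noteq> {}" using a by auto
  qed
  also have "int (card F) \<le> icut X + int (card {a \<in> late. tgt a = v})"
  proof -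
    have "card {b \<in> inner. src b \<notin> X \<and> tgt b \<in> X} \<le> card {b \<in> B. src b \<notin> X \<and> head b \<in> X}"
      using finite_BB by (intro card_mono) (auto simp: head_def)
    moreover have "{e \<in> early. tgt e \<in> X \<or> e \<in> used \<and> s \<in> X} = {e \<in> early. tgt e \<in> X}" using sX by auto
    ultimately have "int (card {b \<in> inner. src b \<notin> X \<and> tgt b \<in> X}) + int (card {e \<in> early. tgt e \<in> X}) \<le> icut X"
      unfolding incut_def sum_of_bool_card[OF finite_BB] sum_of_bool_card[OF fin(1)] by simp
    then show ?thesis
      using card_Un_le[of "{b \<in> inner. src b \<notin> X \<and> tgt b \<in> X} \<union> {e \<in> early. tgt e \<in> X}" "{a \<in> late. tgt a = v}"]
        card_Un_le[of "{b \<in> inner. src b \<notin> X \<and> tgt b \<in> X}" "{e \<in> early. tgt e \<in> X}"]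
      unfolding F_def by linarith
  qed
  also have "\<dots> \<le> int (card {e \<in> early. v \<in> W e}) + int (card {a \<in> late. tgt a = v})"
    using loc_col[of v] assms X by simp
  also have "\<dots> = int (card ({e \<in> early. v \<in> W e} \<union> {a \<in> late. tgt a = v}))"
  proof -
    have "{e \<in> early. v \<in> W e} \<inter> {a \<in> late. tgt a = v} = {}" by (auto simp: early_def late_def)
    then show ?thesis using fin by (subst card_Un_disjoint) auto
  qed
  also have "\<dots> = int (card (col ` ({e \<in> early. v \<in> W e} \<union> {a \<in> late. tgt a = v})))"
  proof -
    have "inj_on col ({e \<in> early. v \<in> W e} \<union> {a \<in> late. tgt a = v})"
      using good entry_leaving by (auto simp: good_colouring_def intro: inj_on_subset)
    then show ?thesis by (simp add: card_image)
  qed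
  also have "\<dots> \<le> int (card (colours_at col' v))"
  proof -
    have "col ` ({e \<in> early. v \<in> W e} \<union> {a \<in> late. tgt a = v}) \<subseteq> colours_at col' v"
    proof
      fix j assume "j \<in> col ` ({e \<in> early. v \<in> W e} \<union> {a \<in> late. tgt a = v})"
      then consider e where "e \<in> early" "v \<in> W e" "j = col e" | a where "a \<in> late" "tgt a = v" "j = col a" by auto
      then show "j \<in> colours_at col' v"
      proof cases
        case 1
        then show ?thesis using W_treach[OF 1(1,2) vs] colours_atI by blast
      next
        case 2
        then show ?thesis using entry_treach[of a] by (intro colours_atI[of a]) auto
      qed
    qed
    then show ?thesis by (simp add: card_mono finite_colours_at)
  qed
  finally show ?thesis by simp
qed

lemma colours_at_old:
  assumes "v \<in> U"
  shows "card (colours_at col v) \<le> card (colours_at col' v)"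
proof (rule card_mono)
  show "finite (colours_at col' v)" by (rule finite_colours_at)
  show "colours_at col v \<subseteq> colours_at col' v"
  proof
    fix j assume "j \<in> colours_at col v"
    then obtain a where a: "a \<in> treach A src tgt tau s col" "tgt a = v" "j = col a" by (auto simp: colours_at_def)
    then have "src a \<in> insert s U" using closed_U assms treach_subset[OF a(1)] by (simp add: closed_above_def)
    then show "j \<in> colours_at col' v" using a treach_old[of a] col'_old[of a]
      by (intro colours_atI[of a]) auto
  qed
qed

lemma good_colouring_extend: "good_colouring (U \<union> C) col'"
  unfolding good_colouring_def
proof (intro conjI ballI impI)
  fix a assume "a \<in> A" "src a = s"
  then show "col' a = a" using col'_old[of a] good by (simp add: good_colouring_def)
next
  have "inj_on col (leaving U)" using good by (simp add: good_colouring_def)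
  then have "inj_on (col \<circ> origin) (leaving (U \<union> C))"
    using origin_inj by (intro comp_inj_on) (auto intro: inj_on_subset)
  then show "inj_on col' (leaving (U \<union> C))" by (simp add: col'_def inj_on_def)
next
  show "leaving (U \<union> C) \<subseteq> treach A src tgt tau s col'"
  proof
    fix a assume "a \<in> leaving (U \<union> C)"
    then have "a \<in> leaving U \<or> a \<in> exits" unfolding leaving_UC by auto
    then show "a \<in> treach A src tgt tau s col'"
      using good treach_old[of a] exit_treach[of a] by (auto simp: good_colouring_def leaving_def)
  qed
next
  fix v assume "v \<in> U \<union> C"
  then show "lambda_N A src tgt tau s v \<le> card (colours_at col' v)"
  proof
    assume "v \<in> U"
    then have "lambda_N A src tgt tau s v \<le> card (colours_at col v)" using good by (simp add: good_colouring_def)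
    then show ?thesis using colours_at_old[OF \<open>v \<in> U\<close>] by linarith
  qed (rule lambda_le_C)
qed

end

subsection \<open>From colourings to arborescences\<close>

context matched_network
begin

section \<open>Passing through the components in topological order\<close>

lemma closed_above_rtrancl:
  assumes "closed_above U" "(w, v) \<in> (arc_rel A src tgt)\<^sup>*" "v \<in> U"
  shows "w \<in> insert s U"
  using assms(2,3)
proof (induction rule: converse_rtrancl_induct)
  case base
  then show ?case by simp
next
  case (step y z)
  then obtain a where a: "a \<in> A" "y = src a" "z = tgt a" by (auto simp: arc_rel_def)
  then have "z \<noteq> s" using arc_ends(2)[OF a(1)] s_notin by auto
  then have "z \<in> U" using step by auto
  then show ?case using assms(1) a by (simp add: closed_above_def)
qed

text \<open>Take the component of a vertex outside \<open>U\<close> with fewest ancestors outside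
  \<open>U\<close>. The tail outside \<open>U\<close> of an arc into it has no fewer, hence the same
  ancestors, and so belongs to it.\<close>

lemma next_component:
  assumes "closed_above U" "U \<noteq> V" and cons: "consistent A src tgt tau"
  shows "\<exists>C t. C \<noteq> {} \<and> U \<inter> C = {} \<and> closed_above (U \<union> C) \<and>
    (\<forall>a\<in>A. src a \<in> C \<longrightarrow> tgt a \<in> C \<longrightarrow> tau a = t)"
proof -
  let ?r = "(arc_rel A src tgt)\<^sup>*"
  define P where "P v = {w \<in> V - U. (w, v) \<in> ?r}" for v
  have "V - U \<noteq> {}" using assms(1,2) by (auto simp: closed_above_def)
  then obtain v where v: "v \<in> V - U" and vmin: "\<And>w. w \<in> V - U \<Longrightarrow> card (P v) \<le> card (P w)"
    using ex_has_least_nat[of "\<lambda>v. v \<in> V - U" _ "\<lambda>v. card (P v)"] by (metis ex_in_conv)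
  define C where "C = {w \<in> V. (w, v) \<in> ?r \<and> (v, w) \<in> ?r}"
  have vC: "v \<in> C" using v by (simp add: C_def)
  have vs: "v \<noteq> s" using v s_notin by auto
  have disj: "U \<inter> C = {}"
  proof (rule ccontr)
    assume "U \<inter> C \<noteq> {}"
    then obtain w where "w \<in> U" "(v, w) \<in> ?r" by (auto simp: C_def)
    then have "v \<in> insert s U" by (intro closed_above_rtrancl[OF assms(1)])
    then show False using v vs by simp
  qed
  have closed: "closed_above (U \<union> C)"
    unfolding closed_above_def
  proof (intro conjI ballI impI)
    show "U \<union> C \<subseteq> V" using assms(1) by (auto simp: closed_above_def C_def)
    fix a assume a: "a \<in> A" "tgt a \<in> U \<union> C"
    show "src a \<in> insert s (U \<union> C)"
    proof (cases "src a \<in> insert s U \<or> tgt a \<in> U")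
      case True
      then show ?thesis using assms(1) a(1) unfolding closed_above_def by blast
    next
      case False
      then have w: "src a \<in> V - U" "tgt a \<in> C" using arc_ends(1)[OF a(1)] a(2) by auto
      have "(src a, tgt a) \<in> arc_rel A src tgt" using a(1) unfolding arc_rel_def by blast
      then have "(src a, tgt a) \<in> ?r" by (rule r_into_rtrancl)
      then have wv: "(src a, v) \<in> ?r" using w(2) rtrancl_trans[of "src a" "tgt a" _ v] unfolding C_def by simp
      then have "P (src a) \<subseteq> P v" unfolding P_def using rtrancl_trans[OF _ wv] by blast
      moreover have "finite (P v)" using finite_V by (simp add: P_def)
      ultimately have "P (src a) = P v" using vmin[OF w(1)] by (intro card_seteq) auto
      then have "(v, src a) \<in> ?r" using v unfolding P_def by blast
      then show ?thesis using wv w(1) by (simp add: C_def)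
    qed
  qed
  have sc: "strongly_conn A src tgt x y" if "x \<in> C" "y \<in> C" for x y
    using that rtrancl_trans[of x v _ y] rtrancl_trans[of y v _ x]
    unfolding C_def strongly_conn_def by simp
  have same: "tau a = tau b" if "a \<in> A" "src a \<in> C" "tgt a \<in> C" "b \<in> A" "src b \<in> C" "tgt b \<in> C" for a b
    using cons that sc[of "src a" "tgt a"] sc[of "src b" "tgt b"] sc[of "src a" "src b"]
    unfolding consistent_def by simp
  have "\<exists>t. \<forall>a\<in>A. src a \<in> C \<longrightarrow> tgt a \<in> C \<longrightarrow> tau a = t"
  proof (cases "\<exists>b\<in>A. src b \<in> C \<and> tgt b \<in> C")
    case True
    then obtain b where "b \<in> A" "src b \<in> C" "tgt b \<in> C" by blast
    then have "\<forall>a\<in>A. src a \<in> C \<longrightarrow> tgt a \<in> C \<longrightarrow> tau a = tau b" using same by blast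
    then show ?thesis by (rule exI)
  next
    case False
    \<comment> \<open>Without inner arcs any time will do; \<open>0\<close> is a default.\<close>
    then have "\<forall>a\<in>A. src a \<in> C \<longrightarrow> tgt a \<in> C \<longrightarrow> tau a = 0" by blast
    then show ?thesis by (rule exI)
  qed
  moreover have "C \<noteq> {}" using vC by blast
  ultimately show ?thesis using disj closed by blast
qed

lemma good_colouring_exists:
  assumes cons: "consistent A src tgt tau"
  shows "\<exists>col. good_colouring V col"
proof -
  have "\<exists>col'. good_colouring V col'" if "closed_above U" "good_colouring U col" for U col
    using that
  proof (induction "card (V - U)" arbitrary: U col rule: less_induct)
    case less
    show ?case
    proof (cases "U = V")
      case True
      then show ?thesis using less.prems by blast
    next
      case False
      obtain C t where C: "C \<noteq> {}" "U \<inter> C = {}"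
        "closed_above (U \<union> C)" and t: "\<forall>a\<in>A. src a \<in> C \<longrightarrow> tgt a \<in> C \<longrightarrow> tau a = t"
        using next_component[OF less.prems(1) False cons] by blast
      interpret component V s A src tgt tau \<phi> U C t col
        by unfold_locales (use C t less.prems in simp_all)
      have "V - (U \<union> C) \<subset> V - U" using C(1,2) C_sub by blast
      then have "card (V - (U \<union> C)) < card (V - U)"
        using finite_V by (intro psubset_card_mono) auto
      from less.hyps[OF this C(3) good_colouring_extend] show ?thesis .
    qed
  qed
  moreover have "closed_above {}" by (simp add: closed_above_def)
  \<comment> \<open>\<open>leaving {}\<close> consists of the arcs leaving \<open>s\<close>, each
    being its own colour.\<close>
  moreover have "good_colouring {} (\<lambda>a. a)"
    by (auto simp: good_colouring_def leaving_def intro: treach.start)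
  ultimately show ?thesis by blast
qed

end

section \<open>Extraction of the trees\<close>

locale coloured_network = matched_network +
  fixes col :: "'b \<Rightarrow> 'b"
  assumes col_root: "a \<in> A \<Longrightarrow> src a = s \<Longrightarrow> col a = a"
begin

abbreviation "T \<equiv> treach A src tgt tau s col"

inductive stage :: "nat \<Rightarrow> 'b \<Rightarrow> bool" where
  start: "a \<in> A \<Longrightarrow> src a = s \<Longrightarrow> stage 0 a"
| step: "stage n a' \<Longrightarrow> a \<in> A \<Longrightarrow> tgt a' = src a \<Longrightarrow> tau a' \<le> tau a \<Longrightarrow> col a = col a' \<Longrightarrow> stage (Suc n) a"

lemma T_stage: "a \<in> T \<Longrightarrow> \<exists>n. stage n a"
  by (induction rule: treach.induct) (metis stage.intros)+

lemma stage_T: "stage n a \<Longrightarrow> a \<in> T"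
  by (induction rule: stage.induct) (metis treach.intros)+

text \<open>
  The key orders reached arcs by time first and by distance from \<open>s\<close> second.
\<close>

lemma key_exists:
  "\<exists>key :: 'b \<Rightarrow> nat. (\<forall>a\<in>T. src a = s \<or>
      (\<exists>a'\<in>T. tgt a' = src a \<and> col a' = col a \<and> key a' < key a)) \<and>
    (\<forall>a\<in>T. \<forall>b\<in>T. key a \<le> key b \<longrightarrow> tau a \<le> tau b)"
proof -
  define r where "r a = (LEAST n. stage n a)" for a
  have r: "stage (r a) a" if "a \<in> T" for a
    unfolding r_def using T_stage[OF that] by (rule LeastI_ex)
  define K where "K = Suc (Max (r ` A))"
  have rK: "r a < K" if "a \<in> T" for a
    using treach_subset[OF that] finite_A by (simp add: K_def le_imp_less_Suc)
  \<comment> \<open>\<open>K\<close> exceeds every \<open>r a\<close> with \<open>a \<in> T\<close>,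
    so the number encodes a lexicographic pair.\<close>
  define key where "key a = tau a * K + r a" for a
  have "src a = s \<or> (\<exists>a'\<in>T. tgt a' = src a \<and> col a' = col a \<and> key a' < key a)" if "a \<in> T" for a
    using r[OF that]
  proof (cases rule: stage.cases)
    case (step n a')
    have "r a' \<le> n" unfolding r_def using step(2) by (rule Least_le)
    then have "r a' < r a" using step(1) by simp
    moreover have "tau a' * K \<le> tau a * K" using step by simp
    ultimately have "key a' < key a" unfolding key_def by linarith
    then show ?thesis using step stage_T by metis
  qed simp
  moreover have "tau a \<le> tau b" if "a \<in> T" "b \<in> T" "key a \<le> key b" for a b
  proof (rule ccontr)
    assume "\<not> tau a \<le> tau b"
    then have "Suc (tau b) * K \<le> tau a * K" by (intro mult_right_mono) auto
    then show False using that(3) rK[OF that(2)] by (simp add: key_def)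
  qed
  ultimately show ?thesis by blast
qed

definition key :: "'b \<Rightarrow> nat" where
  "key = (SOME key. (\<forall>a\<in>T. src a = s \<or>
      (\<exists>a'\<in>T. tgt a' = src a \<and> col a' = col a \<and> key a' < key a)) \<and>
    (\<forall>a\<in>T. \<forall>b\<in>T. key a \<le> key b \<longrightarrow> tau a \<le> tau b))"

lemma key_pred: "a \<in> T \<Longrightarrow> src a \<noteq> s \<Longrightarrow> \<exists>a'\<in>T. tgt a' = src a \<and> col a' = col a \<and> key a' < key a"
  and key_tau: "a \<in> T \<Longrightarrow> b \<in> T \<Longrightarrow> key a \<le> key b \<Longrightarrow> tau a \<le> tau b"
  using someI_ex[OF key_exists, folded key_def] by blast+

definition tree_verts :: "'b \<Rightarrow> 'a set" where
  "tree_verts j = {v. \<exists>a\<in>T. tgt a = v \<and> col a = j}"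

text \<open>A least key means earliest arrival, so whatever can follow some arrival at
  \<open>v\<close> in colour \<open>j\<close> can follow this one. Breaking ties by distance
  excludes cycles of equal time.\<close>

definition parent :: "'b \<Rightarrow> 'a \<Rightarrow> 'b" where
  "parent j v = arg_min key (\<lambda>a. a \<in> T \<and> tgt a = v \<and> col a = j)"

definition "tree_arcs j = parent j ` tree_verts j"

lemma parent:
  assumes "v \<in> tree_verts j"
  shows "parent j v \<in> T" "tgt (parent j v) = v" "col (parent j v) = j"
    "\<And>a. a \<in> T \<Longrightarrow> tgt a = v \<Longrightarrow> col a = j \<Longrightarrow> key (parent j v) \<le> key a"
proof -
  obtain a where "a \<in> T \<and> tgt a = v \<and> col a = j" using assms by (auto simp: tree_verts_def)
  from arg_min_nat_lemma[of "\<lambda>a. a \<in> T \<and> tgt a = v \<and> col a = j", OF this, where m = key]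
  show "parent j v \<in> T" "tgt (parent j v) = v" "col (parent j v) = j"
    "\<And>a. a \<in> T \<Longrightarrow> tgt a = v \<Longrightarrow> col a = j \<Longrightarrow> key (parent j v) \<le> key a"
    unfolding parent_def by blast+
qed

lemma tree_verts_V: "tree_verts j \<subseteq> V"
  using arc_ends(2) treach_subset by (fastforce simp: tree_verts_def)

lemma s_notin_tree: "s \<notin> tree_verts j"
  using tree_verts_V s_notin by blast

lemma tree_arcs_sub: "tree_arcs j \<subseteq> A"
  using parent(1) treach_subset by (fastforce simp: tree_arcs_def)

lemma tree_arcs_eq_parent: "a \<in> tree_arcs j \<Longrightarrow> tgt a \<in> tree_verts j \<and> a = parent j (tgt a)"
  using parent(2) by (auto simp: tree_arcs_def)

lemma parent_src:
  assumes "v \<in> tree_verts j" "src (parent j v) \<noteq> s"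
  shows "src (parent j v) \<in> tree_verts j" "key (parent j (src (parent j v))) < key (parent j v)"
proof -
  obtain a' where a': "a' \<in> T" "tgt a' = src (parent j v)" "col a' = j" "key a' < key (parent j v)"
    using key_pred[OF parent(1)[OF assms(1)] assms(2)] parent(3)[OF assms(1)] by auto
  then show u: "src (parent j v) \<in> tree_verts j" unfolding tree_verts_def by blast
  show "key (parent j (src (parent j v))) < key (parent j v)"
    using parent(4)[OF u a'(1-3)] a'(4) by linarith
qed

text \<open>The successor puts \<open>s\<close> strictly below every tree vertex, even where a key
  is \<open>0\<close>.\<close>

definition depth :: "'b \<Rightarrow> 'a \<Rightarrow> nat" where
  "depth j v = (if v = s then 0 else Suc (key (parent j v)))"

lemma depth_less:
  assumes "v \<in> tree_verts j"
  shows "depth j (src (parent j v)) < depth j v"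
proof -
  have "v \<noteq> s" using assms s_notin_tree by blast
  then show ?thesis using parent_src[OF assms] by (simp add: depth_def)
qed

lemma arborescence_tree: "s_arborescence V s A src tgt (tree_verts j) (tree_arcs j)"
  unfolding s_arborescence_def
proof (intro conjI ballI)
  show "tree_verts j \<subseteq> V" "tree_arcs j \<subseteq> A" by (rule tree_verts_V tree_arcs_sub)+
next
  fix a assume "a \<in> tree_arcs j"
  from tree_arcs_eq_parent[OF this] have a: "tgt a \<in> tree_verts j" "parent j (tgt a) = a" by auto
  then show "src a \<in> tree_verts j \<union> {s}" "tgt a \<in> tree_verts j \<union> {s}"
    using parent_src(1)[OF a(1)] by auto
next
  have "arc_rel (tree_arcs j) src tgt \<subseteq> measure (depth j)"
  proof
    fix x assume "x \<in> arc_rel (tree_arcs j) src tgt"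
    then obtain a where a: "a \<in> tree_arcs j" "x = (src a, tgt a)" by (auto simp: arc_rel_def)
    from tree_arcs_eq_parent[OF a(1)] have "tgt a \<in> tree_verts j" "parent j (tgt a) = a" by auto
    then show "x \<in> measure (depth j)" using depth_less[of "tgt a" j] a(2) by simp
  qed
  then show "acyclic (arc_rel (tree_arcs j) src tgt)"
    using wf_subset[OF wf_measure] wf_acyclic by blast
next
  fix v assume v: "v \<in> tree_verts j"
  have "{a \<in> tree_arcs j. tgt a = v} = {parent j v}"
    using v tree_arcs_eq_parent[of _ j] parent(2)[OF v] by (auto simp: tree_arcs_def)
  then show "card {a \<in> tree_arcs j. tgt a = v} = 1" by simp
qed

lemma tree_path_respecting:
  assumes "is_path (tree_arcs j) src tgt s v es"
  shows "tau_respecting tau es"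
  unfolding tau_respecting_def sorted_iff_nth_Suc
proof (intro allI impI)
  fix i assume i: "Suc i < length (map tau es)"
  have arcs: "es ! i \<in> tree_arcs j" "es ! Suc i \<in> tree_arcs j" and seq: "tgt (es ! i) = src (es ! Suc i)"
    using assms i by (auto simp: is_path_def)
  have u: "tgt (es ! i) \<in> tree_verts j" "es ! i = parent j (tgt (es ! i))"
    using tree_arcs_eq_parent[OF arcs(1)] by blast+
  have w: "tgt (es ! Suc i) \<in> tree_verts j" "es ! Suc i = parent j (tgt (es ! Suc i))"
    using tree_arcs_eq_parent[OF arcs(2)] by blast+
  have "src (parent j (tgt (es ! Suc i))) \<noteq> s" using u(1) w(2) seq s_notin_tree by metis
  from parent_src(2)[OF w(1) this] have "key (es ! i) < key (es ! Suc i)"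
    using u(2) w(2) seq by metis
  moreover have "es ! i \<in> T" "es ! Suc i \<in> T" using parent(1) u w by metis+
  ultimately have "tau (es ! i) \<le> tau (es ! Suc i)" by (intro key_tau) auto
  then show "map tau es ! i \<le> map tau es ! Suc i" using i by simp
qed

text \<open>The bound on depths is carried along to show that \<open>v\<close> does not recur, since
  \<open>is_path\<close> asks for distinct vertices.\<close>

lemma tree_path_exists:
  "v \<in> tree_verts j \<Longrightarrow> \<exists>es. is_path (tree_arcs j) src tgt s v es \<and> (\<forall>u\<in>set (map src es). depth j u < depth j v)"
proof (induction "depth j v" arbitrary: v rule: less_induct)
  case less
  let ?p = "parent j v"
  have p: "?p \<in> tree_arcs j" "tgt ?p = v" using less.prems parent(2) by (auto simp: tree_arcs_def)
  have vs: "v \<noteq> s" using less.prems s_notin_tree by blast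
  note d = depth_less[OF less.prems]
  show ?case
  proof (cases "src ?p = s")
    case True
    then have "is_path (tree_arcs j) src tgt s v [?p]" using p vs by (simp add: is_path_def)
    then show ?thesis using d by (intro exI[of _ "[?p]"]) simp
  next
    case False
    from less.hyps[OF d parent_src(1)[OF less.prems False]] obtain es where
      es: "is_path (tree_arcs j) src tgt s (src ?p) es" "\<forall>u\<in>set (map src es). depth j u < depth j (src ?p)"
      by blast
    have lt: "\<forall>u\<in>set (map src es). depth j u < depth j v" using es(2) d by fastforce
    then have "v \<notin> set (map src es)" by blast
    moreover have "v \<noteq> src ?p" using d by (metis less_irrefl)
    ultimately have "is_path (tree_arcs j) src tgt s v (es @ [?p])"
      using p by (intro is_path_snoc[OF es(1)]) auto
    then show ?thesis using lt d by (intro exI[of _ "es @ [?p]"]) auto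
  qed
qed

lemma col_in_root: "a \<in> T \<Longrightarrow> col a \<in> {a \<in> A. src a = s}"
  by (induction rule: treach.induct) (simp_all add: col_root)

lemma colours_at_eq: "colours_at col v = {j \<in> {a \<in> A. src a = s}. v \<in> tree_verts j}"
  using col_in_root unfolding colours_at_def tree_verts_def by blast

lemma tree_arcs_col: "a \<in> tree_arcs j \<Longrightarrow> col a = j"
  unfolding tree_arcs_def using parent(3) by blast

lemma tree_arcs_disjoint: "j \<noteq> k \<Longrightarrow> tree_arcs j \<inter> tree_arcs k = {}"
  using tree_arcs_col by (metis disjoint_iff)

text \<open>Each colour at \<open>v\<close> has a path inside its own tree, and different trees
  share no arc because a tree arc carries the colour of its tree.\<close>

lemma card_colours_at_le: "card (colours_at col v) \<le> lambda_N A src tgt tau s v"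
proof -
  have "finite (colours_at col v)" by (rule finite_colours_at)
  then obtain js where js: "set js = colours_at col v" "distinct js" "length js = card (colours_at col v)"
    using finite_distinct_list distinct_card by metis
  define path where "path j = (SOME es. is_path (tree_arcs j) src tgt s v es)" for j
  have path: "is_path (tree_arcs j) src tgt s v (path j)" if "j \<in> set js" for j
  proof -
    have "v \<in> tree_verts j" using that unfolding js colours_at_eq by blast
    then have "\<exists>es. is_path (tree_arcs j) src tgt s v es" using tree_path_exists by blast
    then show ?thesis unfolding path_def by (rule someI_ex)
  qed
  have "disjoint_paths A src tgt tau s v (map path js)"
    unfolding disjoint_paths_def
  proof (intro conjI ballI allI impI)
    fix p assume "p \<in> set (map path js)"
    then obtain j where j: "j \<in> set js" "p = path j" by auto
    show "is_path A src tgt s v p" using path[OF j(1)] j(2) tree_arcs_sub[of j] unfolding is_path_def by auto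
    show "tau_respecting tau p" using tree_path_respecting[OF path[OF j(1)]] j(2) by simp
  next
    fix i k assume ik: "i < length (map path js)" "k < length (map path js)" "i \<noteq> k"
    then have "js ! i \<noteq> js ! k" using js(2) by (simp add: nth_eq_iff_index_eq)
    moreover have "set (path (js ! i)) \<subseteq> tree_arcs (js ! i)" "set (path (js ! k)) \<subseteq> tree_arcs (js ! k)"
      using path[of "js ! i"] path[of "js ! k"] ik by (simp_all add: is_path_def)
    ultimately show "set (map path js ! i) \<inter> set (map path js ! k) = {}"
      using tree_arcs_disjoint[of "js ! i" "js ! k"] ik by auto
  qed
  from lambda_N_ge_disjoint_paths[OF finite_A this] show ?thesis using js(3) by simp
qed

end

theorem theorem4:
  fixes V :: "'v set" and s :: 'v and A :: "'e set"
    and src tgt :: "'e \<Rightarrow> 'v" and tau :: "'e \<Rightarrow> nat"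
  assumes "temporal_network V s A src tgt"
    and "consistent A src tgt tau"
    and "pre_flow V A src tgt tau"
  shows "\<exists>Fs :: ('v set \<times> 'e set) list.
           length Fs = out_degree A src s \<and>
           (\<forall>F\<in>set Fs. tau_respecting_arborescence V s A src tgt tau (fst F) (snd F)) \<and>
           (\<forall>i<length Fs. \<forall>j<length Fs. i \<noteq> j \<longrightarrow> snd (Fs ! i) \<inter> snd (Fs ! j) = {}) \<and>
           (\<forall>v\<in>V. card {i. i < length Fs \<and> v \<in> fst (Fs ! i)} = lambda_N A src tgt tau s v)"
proof -
  from preflow_matching[OF assms(1,3)] obtain \<phi> where \<phi>: "inj_on \<phi> {a \<in> A. src a \<in> V}"
    "\<forall>a\<in>A. src a \<in> V \<longrightarrow> \<phi> a \<in> A \<and> tgt (\<phi> a) = src a \<and> tau (\<phi> a) \<le> tau a" by blast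
  interpret matched_network V s A src tgt tau \<phi>
    by unfold_locales (use assms(1) \<phi> in simp_all)
  from good_colouring_exists[OF assms(2)] obtain col where col: "good_colouring V col" ..
  interpret coloured_network V s A src tgt tau \<phi> col
    by unfold_locales (use col in \<open>simp add: good_colouring_def\<close>)
  let ?S = "{a \<in> A. src a = s}"
  have "finite ?S" using finite_A by simp
  from finite_distinct_list[OF this] obtain js where js: "set js = ?S" "distinct js" by blast
  have len: "length js = card ?S" using distinct_card[OF js(2)] js(1) by simp
  define Fs where "Fs = map (\<lambda>j. (tree_verts j, tree_arcs j)) js"
  have count: "card {i. i < length Fs \<and> v \<in> fst (Fs ! i)} = lambda_N A src tgt tau s v" if "v \<in> V" for v
  proof -
    have "bij_betw (\<lambda>i. js ! i) {i. i < length Fs \<and> v \<in> fst (Fs ! i)} (colours_at col v)"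
    proof (rule bij_betwI')
      fix i k assume "i \<in> {i. i < length Fs \<and> v \<in> fst (Fs ! i)}" "k \<in> {i. i < length Fs \<and> v \<in> fst (Fs ! i)}"
      then show "(js ! i = js ! k) = (i = k)" using js(2) by (simp add: Fs_def nth_eq_iff_index_eq)
    next
      fix i assume "i \<in> {i. i < length Fs \<and> v \<in> fst (Fs ! i)}"
      then have i: "i < length js" "v \<in> tree_verts (js ! i)" by (auto simp: Fs_def)
      then have "js ! i \<in> ?S" using js(1) nth_mem by blast
      then show "js ! i \<in> colours_at col v" using i unfolding colours_at_eq by blast
    next
      fix j assume "j \<in> colours_at col v"
      then have j: "j \<in> set js" "v \<in> tree_verts j" unfolding colours_at_eq js(1) by blast+
      then obtain i where "i < length js" "js ! i = j" by (auto simp: in_set_conv_nth)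
      then show "\<exists>i\<in>{i. i < length Fs \<and> v \<in> fst (Fs ! i)}. j = js ! i"
        using j by (intro bexI[of _ i]) (auto simp: Fs_def)
    qed
    then have "card {i. i < length Fs \<and> v \<in> fst (Fs ! i)} = card (colours_at col v)"
      by (rule bij_betw_same_card)
    also have "\<dots> = lambda_N A src tgt tau s v"
      using card_colours_at_le[of v] col that unfolding good_colouring_def by (simp add: le_antisym)
    finally show ?thesis .
  qed
  show ?thesis
  proof (intro exI[of _ Fs] conjI ballI allI impI count)
    show "length Fs = out_degree A src s" using len by (simp add: Fs_def out_degree_def)
  next
    fix F assume "F \<in> set Fs"
    then obtain j where "F = (tree_verts j, tree_arcs j)" by (auto simp: Fs_def)
    then show "tau_respecting_arborescence V s A src tgt tau (fst F) (snd F)"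
      using arborescence_tree tree_path_respecting by (simp add: tau_respecting_arborescence_def)
  next
    fix i k assume ik: "i < length Fs" "k < length Fs" "i \<noteq> k"
    then have "js ! i \<noteq> js ! k" using js(2) by (simp add: Fs_def nth_eq_iff_index_eq)
    then show "snd (Fs ! i) \<inter> snd (Fs ! k) = {}"
      using tree_arcs_disjoint[of "js ! i" "js ! k"] ik by (simp add: Fs_def)
  qed
qed

end
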